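(* Let $\lambda>0$ and let $N$ be a non-negative integer. If $q(x)$ is a real valued trigonometric polynomial of degree at most $N$ such that $q(x)\le\theta_3(x,i\lambda^{-1})$ at each point $x\in\mathbb{R}/\mathbb{Z}$, then $$\int_{\mathbb{R}/\mathbb{Z}}q(x)\,dx\ \le\ \theta_2\bigl(0,i\lambda^{-1}(N+1)^2\bigr),$$ with equality if and only if $q(x)=l_{\lambda,N}(x)$. If $r(x)$ is a real valued trigonometric polynomial of degree at most $N$ such that $\theta_3(x,i\lambda^{-1})\le r(x)$ at each point $x\in\mathbb{R}/\mathbb{Z}$, then $$\theta_3\bigl(0,i\lambda^{-1}(N+1)^2\bigr)\ \le\ \int_{\mathbb{R}/\mathbb{Z}}r(x)\,dx,$$ with equality if and only if $r(x)=m_{\lambda,N}(x)$.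
   Context: With $e(z)=e^{2\pi i z}$ and $\Im\tau>0$, $\theta_2(v,\tau)=\sum_{n\in\mathbb{Z}}(-1)^n e^{\pi i\tau n^2}e(nv)$ and $\theta_3(v,\tau)=\sum_{n\in\mathbb{Z}}e^{\pi i\tau n^2}e(nv)$. A trigonometric polynomial of degree at most $N$ is $\sum_{n=-N}^N c_n e(nx)$ with $c_n\in\mathbb{C}$. For $\mu>0$, $G_\mu(z)=e^{-\pi\mu z^2}$ and (removable singularities filled in) $$L_\mu(z)=\Bigl(\frac{\cos\pi z}{\pi}\Bigr)^2\Bigl\{\sum_{m\in\mathbb{Z}}\frac{G_\mu(m+\frac12)}{(z-m-\frac12)^2}+\sum_{n\in\mathbb{Z}}\frac{G_\mu'(n+\frac12)}{z-n-\frac12}\Bigr\},$$ $$M_\mu(z)=\Bigl(\frac{\sin\pi z}{\pi}\Bigr)^2\Bigl\{\sum_{m\in\mathbb{Z}}\frac{G_\mu(m)}{(z-m)^2}+\sum_{n\in\mathbb{Z}}\frac{G_\mu'(n)}{z-n}\Bigr\},$$ with Fourier transforms $\widehat f(t)=\int_{-\infty}^\infty f(x)e(-xt)\,dx$. Define $$l_{\lambda,N}(x)=\lambda^{1/2}\sum_{n\in\mathbb{Z}}L_{(N+1)^{-2}\lambda}\bigl((N+1)(x+n)\bigr)=\lambda^{1/2}(N+1)^{-1}\sum_{n=-N}^N\widehat{L}_{(N+1)^{-2}\lambda}\Bigl(\frac{n}{N+1}\Bigr)e(nx),$$ $$m_{\lambda,N}(x)=\lambda^{1/2}\sum_{n\in\mathbb{Z}}M_{(N+1)^{-2}\lambda}\bigl((N+1)(x+n)\bigr)=\lambda^{1/2}(N+1)^{-1}\sum_{n=-N}^N\widehat{M}_{(N+1)^{-2}\lambda}\Bigl(\frac{n}{N+1}\Bigr)e(nx)$$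 (the expressions agree by Poisson summation); these are real valued trigonometric polynomials of degree at most $N$. *)

theory Defs
  imports "HOL-Complex_Analysis.Complex_Analysis"
begin

definition e2pi :: "complex \<Rightarrow> complex" where
  "e2pi z = exp (2 * of_real pi * \<i> * z)"

definition theta2 :: "complex \<Rightarrow> complex \<Rightarrow> complex" where
  "theta2 v \<tau> = (\<Sum>\<^sub>\<infinity>n\<in>(UNIV :: int set).
     (-1) powi n * exp (of_real pi * \<i> * \<tau> * of_int n ^ 2) * e2pi (of_int n * v))"

definition theta3 :: "complex \<Rightarrow> complex \<Rightarrow> complex" where
  "theta3 v \<tau> = (\<Sum>\<^sub>\<infinity>n\<in>(UNIV :: int set).
     exp (of_real pi * \<i> * \<tau> * of_int n ^ 2) * e2pi (of_int n * v))"

text \<open>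
  For real \<open>v\<close> and purely imaginary \<open>\<tau>\<close> in the upper half-plane both theta values are real, so
  taking \<open>Re\<close> to compare them with real numbers loses nothing.
\<close>

definition trig_poly :: "nat \<Rightarrow> (real \<Rightarrow> complex) \<Rightarrow> bool" where
  "trig_poly N f \<longleftrightarrow> (\<exists>c :: int \<Rightarrow> complex.
     \<forall>x. f x = (\<Sum>n = - int N..int N. c n * e2pi (of_int n * of_real x)))"

definition real_trig_poly :: "nat \<Rightarrow> (real \<Rightarrow> real) \<Rightarrow> bool" where
  "real_trig_poly N q \<longleftrightarrow> trig_poly N (\<lambda>x. complex_of_real (q x))"

definition gauss :: "real \<Rightarrow> complex \<Rightarrow> complex" where
  "gauss \<mu> z = exp (- of_real (pi * \<mu>) * z ^ 2)"

text \<open>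
  With division by zero equal to zero, the displayed formulas for \<open>L_fun\<close> and \<open>M_fun\<close> give the wrong
  value at the interpolation nodes; \<^const>\<open>remove_sings\<close> replaces it by the limit at the node
  and changes nothing elsewhere.
\<close>

definition L_fun :: "real \<Rightarrow> complex \<Rightarrow> complex" where
  "L_fun \<mu> = remove_sings (\<lambda>z. (cos (of_real pi * z) / of_real pi) ^ 2 *
     ((\<Sum>\<^sub>\<infinity>m\<in>(UNIV :: int set). gauss \<mu> (of_int m + 1/2) / (z - of_int m - 1/2) ^ 2) +
      (\<Sum>\<^sub>\<infinity>n\<in>(UNIV :: int set). deriv (gauss \<mu>) (of_int n + 1/2) / (z - of_int n - 1/2))))"

definition M_fun :: "real \<Rightarrow> complex \<Rightarrow> complex" where
  "M_fun \<mu> = remove_sings (\<lambda>z. (sin (of_real pi * z) / of_real pi) ^ 2 *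
     ((\<Sum>\<^sub>\<infinity>m\<in>(UNIV :: int set). gauss \<mu> (of_int m) / (z - of_int m) ^ 2) +
      (\<Sum>\<^sub>\<infinity>n\<in>(UNIV :: int set). deriv (gauss \<mu>) (of_int n) / (z - of_int n))))"

text \<open>
  By Poisson summation the periodizations below equal the trigonometric polynomials of degree at
  most \<open>N\<close> with coefficients \<open>sqrt lam / (N+1)\<close> times the Fourier transform of \<open>L_fun\<close>
  (respectively \<open>M_fun\<close>), with parameter \<open>lam / (N+1)^2\<close>, at \<open>n/(N+1)\<close>. Their values are real,
  although typed as complex.
\<close>

definition l_poly :: "real \<Rightarrow> nat \<Rightarrow> real \<Rightarrow> complex" where
  "l_poly lam N x = of_real (sqrt lam) * (\<Sum>\<^sub>\<infinity>n\<in>(UNIV :: int set).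
     L_fun (lam / real (N + 1) ^ 2) (of_real (real (N + 1) * (x + of_int n))))"

definition m_poly :: "real \<Rightarrow> nat \<Rightarrow> real \<Rightarrow> complex" where
  "m_poly lam N x = of_real (sqrt lam) * (\<Sum>\<^sub>\<infinity>n\<in>(UNIV :: int set).
     M_fun (lam / real (N + 1) ^ 2) (of_real (real (N + 1) * (x + of_int n))))"

end

theory Submission
  imports Defs "HOL-Probability.Characteristic_Functions"
begin

text \<open>
  Put \<open>K = N + 1\<close> and let \<open>P x = sqrt lam * (\<Sum>\<^sub>\<infinity>n. exp (- pi * lam * (x + n)\<^sup>2))\<close>. Poisson summation for
  the Gaussian says that \<open>P\<close> is the theta function to be bounded
  (\<open>theta3_eq_gauss_periodization\<close>). For the minorants take the shift \<open>c = 1/2\<close>, for the majorants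
  \<open>c = 0\<close>, and consider the \<open>K\<close> equally spaced nodes \<open>X j = (j + c) / K\<close> in one period.

  The average over the nodes annihilates every \<open>e2pi (n * x)\<close> with \<open>0 < \<bar>n\<bar> < K\<close>, so it computes the
  integral of a trigonometric polynomial of degree at most \<open>N\<close> exactly
  (\<open>trig_poly_quadrature\<close>). The same average of \<open>P\<close> runs once through the lattice \<open>(\<int> + c) / K\<close> and is
  therefore the Gaussian sum with parameter \<open>lam / K\<^sup>2\<close> at the point \<open>c\<close>
  (\<open>average_gauss_periodization\<close>), that is, the theta value in the theorem. Hence the bound minus
  the integral of \<open>q\<close> is the average of \<open>P - q\<close> over the nodes, and the inequality is the sign of
  \<open>P - q\<close>.

  In the case of equality \<open>P - q\<close> vanishes at all nodes; it has an extremum there, so its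
  derivative vanishes too. The \<open>2 * K\<close> values and derivatives determine \<open>q\<close> by an explicit Hermite
  interpolation formula (\<open>trig_poly_hermite\<close>). It remains to see that \<open>l_poly\<close> and \<open>m_poly\<close> are given
  by the same formula with the data of \<open>P\<close>. Off the nodes this comes from exchanging the
  summation over the periods with the summation over the interpolation points of \<open>L_fun\<close> or
  \<open>M_fun\<close>: the sum over the periods turns \<open>1 / (z - a)\<^sup>2\<close> into a squared cosecant and \<open>1 / (z - a)\<close> into a
  cotangent (\<open>has_sum_periodized_interpolation_series\<close>). The terms with a simple pole do not form
  an absolutely summable double series as they stand; oddness of the derivative of the Gaussian is
  used to pair the interpolation points \<open>a\<close> and \<open>- a\<close>. At its interpolation points each of \<open>L_fun\<close> and
  \<open>M_fun\<close> takes the values of the Gaussian, so that \<open>l_poly\<close> and \<open>m_poly\<close> agree with \<open>P\<close> at the nodes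
  (\<open>nodal_poly_at_node\<close>); this also gives the converse direction of the equality statement.
\<close>

section \<open>Sums over the integers and Gaussian majorants\<close>

lemma has_sum_int_split:
  fixes f :: "int \<Rightarrow> 'a :: {topological_comm_monoid_add}"
  assumes "((\<lambda>n::nat. f (int n)) has_sum A) UNIV"
    and "((\<lambda>n::nat. f (- int n - 1)) has_sum B) UNIV"
  shows "(f has_sum (A + B)) UNIV"
proof -
  have "(f has_sum A) (range int)"
    using assms(1) by (subst has_sum_reindex) (auto simp: o_def)
  moreover have "(f has_sum B) (range (\<lambda>n::nat. - int n - 1))"
    using assms(2) by (subst has_sum_reindex) (auto simp: o_def inj_on_def)
  moreover have "range int \<inter> range (\<lambda>n::nat. - int n - 1) = {}"
    by auto
  ultimately have "(f has_sum (A + B)) (range int \<union> range (\<lambda>n::nat. - int n - 1))"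
    by (rule has_sum_Un_disjoint)
  moreover have "range int \<union> range (\<lambda>n::nat. - int n - 1) = UNIV"
  proof -
    have "x \<in> range int \<or> x \<in> range (\<lambda>n::nat. - int n - 1)" for x :: int
    proof (cases "x \<ge> 0")
      case True
      then have "x = int (nat x)" by simp
      then show ?thesis by blast
    next
      case False
      then have "x = - int (nat (- x - 1)) - 1" by simp
      then show ?thesis by blast
    qed
    then show ?thesis by blast
  qed
  ultimately show ?thesis by simp
qed

lemma summable_on_gaussian:
  fixes a :: real
  assumes "a > 0"
  shows "(\<lambda>n::int. exp (- a * real_of_int n ^ 2)) summable_on UNIV"
proof -
  have nat: "(\<lambda>n::nat. exp (- a * real n ^ 2)) summable_on UNIV"
  proof (rule summable_nonneg_imp_summable_on)
    have "summable (\<lambda>n::nat. exp (- a) ^ n)"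
      using assms by (intro summable_geometric) auto
    then show "summable (\<lambda>n::nat. exp (- a * real n ^ 2))"
    proof (rule summable_comparison_test')
      fix n :: nat
      have "real n \<le> real n ^ 2"
        by (cases n) (auto simp: power2_eq_square algebra_simps)
      then have "- a * real n ^ 2 \<le> real n * (- a)"
        using assms by (simp add: mult.commute)
      then show "norm (exp (- a * real n ^ 2)) \<le> exp (- a) ^ n"
        by (simp add: exp_of_nat_mult[symmetric])
    qed
  qed auto
  have neg: "(\<lambda>n::nat. exp (- a * real_of_int (- int n - 1) ^ 2)) summable_on UNIV"
  proof (rule summable_on_comparison_test[OF nat])
    fix n :: nat
    have "(real n)\<^sup>2 \<le> (real_of_int (- int n - 1))\<^sup>2"
      by (simp add: power2_eq_square algebra_simps)
    then show "exp (- a * real_of_int (- int n - 1) ^ 2) \<le> exp (- a * real n ^ 2)"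
      using assms by simp
  qed auto
  show ?thesis
    using has_sum_int_split[of "\<lambda>n::int. exp (- a * real_of_int n ^ 2)"] nat neg
    by (fastforce simp: summable_on_def)
qed

text \<open>
  Since \<open>(x + n)\<^sup>2 \<ge> n\<^sup>2 / 2 - x\<^sup>2\<close>, half of the exponent dominates the shift uniformly for \<open>\<bar>x\<bar> \<le> R\<close>; the
  other half absorbs the linear weight. The weight makes the majorant serve the termwise
  derivatives as well.
\<close>

lemma weighted_shifted_gaussian_le_majorant:
  fixes a R x :: real and n :: int
  assumes "a > 0" "\<bar>x\<bar> \<le> R"
  shows "(1 + \<bar>x + n\<bar>) * exp (- a * (x + n) ^ 2) \<le>
           (2 + 2 / a) * exp (a * R ^ 2 / 2) * exp (- (a / 4) * real_of_int n ^ 2)"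
proof -
  define t where "t = \<bar>x + n\<bar>"
  have "1 + t \<le> 2 + t ^ 2"
    using sum_power2_ge_zero[of "t - 1/2" 0] by (simp add: power2_eq_square algebra_simps)
  also have "\<dots> \<le> (2 + 2 / a) * (1 + a * t ^ 2 / 2)"
    using assms by (simp add: field_simps)
  also have "\<dots> \<le> (2 + 2 / a) * exp (a * t ^ 2 / 2)"
    using assms exp_ge_add_one_self[of "a * t ^ 2 / 2"] by (intro mult_left_mono) auto
  finally have 1: "1 + t \<le> (2 + 2 / a) * exp (a * t ^ 2 / 2)" .
  have "(1 + t) * exp (- a * t ^ 2) \<le> (2 + 2 / a) * exp (a * t ^ 2 / 2) * exp (- a * t ^ 2)"
    using 1 by (intro mult_right_mono) auto
  also have "\<dots> = (2 + 2 / a) * exp (- a * t ^ 2 / 2)"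
    by (simp add: mult.assoc exp_add[symmetric])
  also have "\<dots> \<le> (2 + 2 / a) * exp (a * R ^ 2 / 2 + (- (a / 4) * real_of_int n ^ 2))"
  proof (rule mult_left_mono)
    have "x ^ 2 \<le> R ^ 2"
      using assms(2) abs_le_square_iff[of x R] by simp
    moreover have "(x + n) ^ 2 + x ^ 2 - real_of_int n ^ 2 / 2 = 2 * (x + n / 2) ^ 2"
      by (simp add: power2_eq_square field_simps)
    moreover have "2 * (x + n / 2) ^ 2 \<ge> 0" by simp
    ultimately have "real_of_int n ^ 2 / 2 - R ^ 2 \<le> t ^ 2"
      unfolding t_def power2_abs by linarith
    then have "a / 2 * (real_of_int n ^ 2 / 2 - R ^ 2) \<le> a / 2 * t ^ 2"
      using assms by (intro mult_left_mono) auto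
    then show "exp (- a * t ^ 2 / 2) \<le> exp (a * R ^ 2 / 2 + (- (a / 4) * real_of_int n ^ 2))"
      by (simp add: algebra_simps)
  qed (use assms in auto)
  finally show ?thesis
    unfolding exp_add by (simp add: t_def mult.assoc)
qed

lemma shifted_gaussian_le_majorant:
  fixes a R x :: real and n :: int
  assumes "a > 0" "\<bar>x\<bar> \<le> R"
  shows "exp (- a * (x + n) ^ 2) \<le>
           (2 + 2 / a) * exp (a * R ^ 2 / 2) * exp (- (a / 4) * real_of_int n ^ 2)"
proof -
  have "exp (- a * (x + n) ^ 2) \<le> (1 + \<bar>x + n\<bar>) * exp (- a * (x + n) ^ 2)"
    by (simp add: distrib_right)
  then show ?thesis
    using weighted_shifted_gaussian_le_majorant[OF assms, of n] by linarith
qed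

lemma summable_on_gaussian_majorant:
  fixes a C :: real
  assumes "a > 0"
  shows "(\<lambda>n::int. C * exp (- (a / 4) * real_of_int n ^ 2)) summable_on UNIV"
  using summable_on_gaussian[of "a / 4"] assms by (intro summable_on_cmult_right) auto

lemma summable_on_weighted_shifted_gaussian:
  fixes a x :: real
  assumes "a > 0"
  shows "(\<lambda>n::int. (1 + \<bar>x + n\<bar>) * exp (- a * (x + n) ^ 2)) summable_on UNIV"
  using summable_on_gaussian_majorant[OF assms]
  by (rule summable_on_comparison_test)
     (use weighted_shifted_gaussian_le_majorant[OF assms, of x "\<bar>x\<bar>"] in \<open>auto intro: mult_nonneg_nonneg\<close>)

lemma summable_on_shifted_gaussian:
  fixes a x :: real
  assumes "a > 0"
  shows "(\<lambda>n::int. exp (- a * (x + n) ^ 2)) summable_on UNIV"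
    "(\<lambda>n::int. (x + n) * exp (- a * (x + n) ^ 2)) summable_on UNIV"
    "(\<lambda>n::int. \<bar>x + n\<bar> * exp (- a * (x + n) ^ 2)) summable_on UNIV"
proof -
  note S = summable_on_weighted_shifted_gaussian[OF assms, of x]
  show "(\<lambda>n::int. exp (- a * (x + n) ^ 2)) summable_on UNIV"
    by (rule summable_on_comparison_test[OF S]) auto
  show *: "(\<lambda>n::int. \<bar>x + n\<bar> * exp (- a * (x + n) ^ 2)) summable_on UNIV"
    by (rule summable_on_comparison_test[OF S]) auto
  show "(\<lambda>n::int. (x + n) * exp (- a * (x + n) ^ 2)) summable_on UNIV"
    by (rule abs_summable_summable) (use * in \<open>simp add: abs_mult\<close>)
qed

lemma summable_on_gaussian_second_moment:
  fixes a c :: real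
  assumes "a > 0"
  shows "(\<lambda>m::int. (c + of_int m) ^ 2 * exp (- a * (c + of_int m) ^ 2)) summable_on UNIV"
proof (rule summable_on_comparison_test)
  show "(\<lambda>m::int. 2 / a * exp (- (a / 2) * (c + of_int m) ^ 2)) summable_on UNIV"
    using assms by (intro summable_on_cmult_right summable_on_shifted_gaussian) auto
  fix m :: int
  define t where "t = (c + of_int m) ^ 2"
  have "a / 2 * t \<le> exp (a / 2 * t)"
    using exp_ge_add_one_self[of "a / 2 * t"] by linarith
  then have "t * exp (- a * t) \<le> 2 / a * exp (a / 2 * t) * exp (- a * t)"
    using assms by (intro mult_right_mono) (auto simp: field_simps)
  also have "\<dots> = 2 / a * exp (- (a / 2) * t)"
    by (simp add: mult.assoc exp_add[symmetric] field_simps)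
  finally show "(c + of_int m) ^ 2 * exp (- a * (c + of_int m) ^ 2) \<le> 2 / a * exp (- (a / 2) * (c + of_int m) ^ 2)"
    by (simp add: t_def)
qed auto

lemma continuous_on_infsum:
  fixes u :: "'i \<Rightarrow> 'a::topological_space \<Rightarrow> 'b::banach"
  assumes "\<And>n. n \<in> I \<Longrightarrow> continuous_on S (u n)"
    and "\<And>n x. n \<in> I \<Longrightarrow> x \<in> S \<Longrightarrow> norm (u n x) \<le> M n" "M summable_on I"
  shows "continuous_on S (\<lambda>x. \<Sum>\<^sub>\<infinity>n\<in>I. u n x)"
proof (rule uniform_limit_theorem)
  show "uniform_limit S (\<lambda>X y. \<Sum>x\<in>X. u x y) (\<lambda>x. \<Sum>\<^sub>\<infinity>n\<in>I. u n x) (finite_subsets_at_top I)"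
    using assms(2,3) by (intro Weierstrass_m_test_general[where M = M]) auto
  show "\<forall>\<^sub>F X in finite_subsets_at_top I. continuous_on S (\<lambda>y. \<Sum>x\<in>X. u x y)"
    using assms(1) by (intro eventually_finite_subsets_at_top_weakI continuous_on_sum) auto
qed simp

text \<open>
  The Weierstrass test for index sets without an order: the finite partial sums converge
  uniformly along the filter of finite subsets, and uniform limits commute with the integral.
\<close>

lemma has_sum_integral_of_majorant:
  fixes u :: "'i \<Rightarrow> real \<Rightarrow> real"
  assumes "\<And>n. continuous_on {a..b} (u n)" "\<And>n x. x \<in> {a..b} \<Longrightarrow> \<bar>u n x\<bar> \<le> M n"
    and "M summable_on UNIV"
  shows "((\<lambda>n. integral {a..b} (u n)) has_sum integral {a..b} (\<lambda>x. \<Sum>\<^sub>\<infinity>n. u n x)) UNIV"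
proof -
  have "uniform_limit {a..b} (\<lambda>X y. \<Sum>x\<in>X. u x y) (\<lambda>x. \<Sum>\<^sub>\<infinity>n. u n x) (finite_subsets_at_top UNIV)"
    using assms(2,3) by (intro Weierstrass_m_test_general[where M = M]) auto
  moreover have "continuous_on {a..b} (\<lambda>y. \<Sum>x\<in>X. u x y)" for X
    by (intro continuous_on_sum assms(1))
  ultimately obtain I J where IJ:
    "\<And>X. ((\<lambda>y. \<Sum>x\<in>X. u x y) has_integral I X) {a..b}"
    "((\<lambda>x. \<Sum>\<^sub>\<infinity>n. u n x) has_integral J) {a..b}"
    "(I \<longlongrightarrow> J) (finite_subsets_at_top UNIV)"
    by (rule uniform_limit_integral) auto
  have "sum (\<lambda>n. integral {a..b} (u n)) X = I X" if "finite X" for X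
  proof -
    have "((\<lambda>y. \<Sum>x\<in>X. u x y) has_integral (\<Sum>n\<in>X. integral {a..b} (u n))) {a..b}"
      using that assms(1)
      by (intro has_integral_sum) (auto intro!: integrable_integral integrable_continuous_real)
    then show ?thesis using IJ(1) has_integral_unique by blast
  qed
  then have "eventually (\<lambda>X. I X = sum (\<lambda>n. integral {a..b} (u n)) X) (finite_subsets_at_top UNIV)"
    by (intro eventually_finite_subsets_at_top_weakI) auto
  then have "(sum (\<lambda>n. integral {a..b} (u n)) \<longlongrightarrow> J) (finite_subsets_at_top UNIV)"
    using IJ(3) by (rule Lim_transform_eventually[rotated])
  then show ?thesis
    using IJ(2) by (simp add: has_sum_def integral_unique)
qed

section \<open>Uniqueness of even cosine series\<close>

lemma periodic_of_int:
  fixes h :: "real \<Rightarrow> 'a"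
  assumes "\<And>x. h (x + 1) = h x"
  shows "h (x + of_int n) = h x"
proof (induction n rule: int_induct[where k = 0])
  case (step1 i)
  then show ?case using assms[of "x + of_int i"] by (simp add: add.assoc)
next
  case (step2 i)
  then show ?case using assms[of "x + of_int (i - 1)"] by simp
qed auto

text \<open>
  An even function of period 1 is a continuous function \<open>H\<close> of \<open>cos (2 * pi * x)\<close>, so it can be
  approximated uniformly by polynomials in \<open>cos (2 * pi * x)\<close>. These are cosine polynomials, to
  which \<open>h\<close> is orthogonal; hence the integral of \<open>h\<^sup>2\<close> is arbitrarily small.
\<close>

lemma even_periodic_eq_0_if_cos_moments_0:
  fixes h :: "real \<Rightarrow> real"
  assumes cont: "continuous_on UNIV h"
    and per: "\<And>x. h (x + 1) = h x" and even: "\<And>x. h (- x) = h x"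
    and mom: "\<And>k::int. integral {0..1} (\<lambda>x. h x * cos (2 * pi * k * x)) = 0"
  shows "h x = 0"
proof -
  have cont': "continuous_on S h" for S
    using cont continuous_on_subset by blast
  \<comment> \<open>Multiplying by one more cosine shifts the frequency by one in both directions, so all powers
    of the cosine are reached from the moments.\<close>
  have cosmom: "integral {0..1} (\<lambda>x. h x * cos (2 * pi * x) ^ m * cos (2 * pi * k * x)) = 0"
    for m :: nat and k :: int
  proof (induction m arbitrary: k)
    case 0
    show ?case using mom[of k] by simp
  next
    case (Suc m)
    define v where "v = (\<lambda>(k::int) x. h x * cos (2 * pi * x) ^ m * cos (2 * pi * k * x))"
    have vi: "v k integrable_on {0..1}" for k
      unfolding v_def by (intro integrable_continuous_real continuous_intros cont')
    have "h x * cos (2 * pi * x) ^ Suc m * cos (2 * pi * k * x) = (1/2) * v (k + 1) x + (1/2) * v (k - 1) x"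
      for x
    proof -
      have "cos (2 * pi * x) * cos (2 * pi * k * x) =
              (cos (2 * pi * (k + 1) * x) + cos (2 * pi * (k - 1) * x)) / 2"
        using cos_add[of "2 * pi * k * x" "2 * pi * x"] cos_diff[of "2 * pi * k * x" "2 * pi * x"]
        by (simp add: algebra_simps)
      moreover have "h x * cos (2 * pi * x) ^ Suc m * cos (2 * pi * k * x) =
          h x * cos (2 * pi * x) ^ m * (cos (2 * pi * x) * cos (2 * pi * k * x))"
        by simp
      ultimately show ?thesis
        unfolding v_def by (simp only:) (simp add: add_divide_distrib distrib_left)
    qed
    moreover have "integral {0..1} (\<lambda>x. (1/2) * v (k + 1) x + (1/2) * v (k - 1) x) =
        (1/2) * integral {0..1} (v (k + 1)) + (1/2) * integral {0..1} (v (k - 1))"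
      using vi by (subst integral_add) (auto intro: integrable_on_mult_right)
    ultimately show ?case
      using Suc[of "k + 1"] Suc[of "k - 1"] by (simp add: v_def)
  qed
  define H where "H t = h (arccos t / (2 * pi))" for t
  have H: "h x = H (cos (2 * pi * x))" if "x \<in> {0..1}" for x
  proof (cases "x \<le> 1/2")
    case True
    then have "arccos (cos (2 * pi * x)) = 2 * pi * x"
      using that by (intro arccos_cos) auto
    then show ?thesis by (simp add: H_def)
  next
    case False
    have "cos (2 * pi * x) = cos (2 * pi * (1 - x))"
      by (simp add: right_diff_distrib cos_diff)
    moreover have "arccos (cos (2 * pi * (1 - x))) = 2 * pi * (1 - x)"
      using False that by (intro arccos_cos) auto
    ultimately show ?thesis
      using per[of "- x"] even[of x] by (simp add: H_def)
  qed
  have contH: "continuous_on {-1..1} H"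
    unfolding H_def
    by (rule continuous_on_compose2[OF cont]) (auto intro!: continuous_intros)
  define B where "B = integral {0..1} (\<lambda>x. \<bar>h x\<bar>)"
  have B: "B \<ge> 0" unfolding B_def by (rule integral_nonneg) (auto intro!: integrable_continuous_real continuous_intros cont')
  have small: "integral {0..1} (\<lambda>x. h x ^ 2) \<le> e * B" if "e > 0" for e
  proof -
    obtain g where g: "real_polynomial_function g" "\<And>t. t \<in> {-1..1} \<Longrightarrow> \<bar>H t - g t\<bar> < e"
      by (rule Stone_Weierstrass_real_polynomial_function[of "{-1..1}" H e]) (use contH \<open>e > 0\<close> in auto)
    from g(1) obtain a n where an: "g = (\<lambda>t. \<Sum>i\<le>n. a i * t ^ i)"
      by (auto simp: real_polynomial_function_iff_sum)
    have "integral {0..1} (\<lambda>x. h x * g (cos (2 * pi * x))) =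
            (\<Sum>i\<le>n. integral {0..1} (\<lambda>x. a i * (h x * cos (2 * pi * x) ^ i)))"
      unfolding an
      by (subst integral_sum[symmetric])
         (auto intro!: integrable_continuous_real continuous_intros cont' simp: sum_distrib_left mult_ac)
    also have "\<dots> = 0"
      using cosmom[of _ 0] by simp
    finally have 0: "integral {0..1} (\<lambda>x. h x * g (cos (2 * pi * x))) = 0" .
    have contg: "continuous_on {0..1} (\<lambda>x. g (cos (2 * pi * x)))"
      unfolding an by (intro continuous_intros)
    have "integral {0..1} (\<lambda>x. h x ^ 2) =
            integral {0..1} (\<lambda>x. h x ^ 2) - integral {0..1} (\<lambda>x. h x * g (cos (2 * pi * x)))"
      using 0 by simp
    also have "\<dots> = integral {0..1} (\<lambda>x. h x ^ 2 - h x * g (cos (2 * pi * x)))"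
      by (rule integral_diff[symmetric])
         (intro integrable_continuous_real continuous_intros cont' contg)+
    also have "\<dots> \<le> integral {0..1} (\<lambda>x. e * \<bar>h x\<bar>)"
    proof (rule integral_le)
      fix x :: real assume x: "x \<in> {0..1}"
      have "h x ^ 2 - h x * g (cos (2 * pi * x)) = h x * (H (cos (2 * pi * x)) - g (cos (2 * pi * x)))"
        using H[OF x] by (simp add: power2_eq_square right_diff_distrib)
      also have "\<dots> \<le> \<bar>h x\<bar> * \<bar>H (cos (2 * pi * x)) - g (cos (2 * pi * x))\<bar>"
        by (metis abs_ge_self abs_mult)
      also have "\<dots> \<le> \<bar>h x\<bar> * e"
        using g(2)[of "cos (2 * pi * x)"] by (intro mult_left_mono) auto
      finally show "h x ^ 2 - h x * g (cos (2 * pi * x)) \<le> e * \<bar>h x\<bar>"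
        by (simp add: mult.commute)
    qed (intro integrable_continuous_real continuous_intros cont' contg)+
    also have "\<dots> = e * B" by (simp add: B_def)
    finally show ?thesis .
  qed
  have "integral {0..1} (\<lambda>x. h x ^ 2) \<le> 0"
  proof (rule field_le_epsilon)
    fix e :: real assume "e > 0"
    then have "integral {0..1} (\<lambda>x. h x ^ 2) \<le> e / (B + 1) * B"
      using B by (intro small) auto
    also have "\<dots> \<le> e" using B \<open>e > 0\<close> by (simp add: field_simps)
    finally show "integral {0..1} (\<lambda>x. h x ^ 2) \<le> 0 + e" by simp
  qed
  moreover have "integral {0..1} (\<lambda>x. h x ^ 2) \<ge> 0"
    by (rule integral_nonneg) (auto intro!: integrable_continuous_real continuous_intros cont')
  ultimately have "integral {0..1} (\<lambda>x. h x ^ 2) = 0" by simp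
  moreover have "continuous_on {0..1} (\<lambda>x. h x ^ 2)"
    by (intro continuous_intros cont')
  ultimately have zero: "h x = 0" if "x \<in> {0..1}" for x
    using integral_eq_0_iff[of 0 1 "\<lambda>x. h x ^ 2"] that by auto
  have "h x = h (frac x + of_int \<lfloor>x\<rfloor>)" by (simp add: frac_def)
  also have "\<dots> = h (frac x)" by (rule periodic_of_int[of h]) (rule per)
  also have "\<dots> = 0" using frac_lt_1[of x] by (intro zero) (auto intro: less_imp_le)
  finally show ?thesis .
qed

section \<open>Poisson summation for the Gaussian\<close>

lemma has_integral_cos_period:
  fixes m :: int
  shows "((\<lambda>x. cos (2 * pi * m * x)) has_integral of_bool (m = 0)) {0..1}"
proof (cases "m = 0")
  case True
  then show ?thesis using has_integral_const_real[of "1::real" 0 1] by simp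
next
  case False
  have "((\<lambda>x. cos (2 * pi * m * x)) has_integral
          (sin (2 * pi * m * 1) / (2 * pi * m) - sin (2 * pi * m * 0) / (2 * pi * m))) {0..1}"
    using False
    by (intro fundamental_theorem_of_calculus)
       (auto intro!: derivative_eq_intros simp: has_real_derivative_iff_has_vector_derivative[symmetric])
  moreover have "sin (2 * pi * m) = 0"
    using sin_integer_2pi[of "real_of_int m"] by (simp add: mult_ac)
  ultimately show ?thesis using False by simp
qed

text \<open>
  The Fourier transform of a Gaussian, rescaled from the characteristic function of the standard
  normal distribution.
\<close>

lemma gaussian_cos_transform:
  fixes a \<xi> :: real
  assumes "a > 0"
  shows "has_bochner_integral lborel (\<lambda>x. exp (- pi * a * x ^ 2) * cos (2 * pi * \<xi> * x))
           (exp (- pi * \<xi> ^ 2 / a) / sqrt a)"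
proof -
  \<comment> \<open>The substitution \<open>s * x\<close> turns \<open>exp (- x\<^sup>2 / 2)\<close> into the Gaussian of parameter \<open>a\<close>.\<close>
  define s where "s = sqrt (2 * pi * a)"
  have s: "s > 0" "s ^ 2 = 2 * pi * a" using assms by (auto simp: s_def)
  define t where "t = 2 * pi * \<xi> / s"
  let ?M = std_normal_distribution
  have int: "integrable ?M (\<lambda>x. iexp (t * x))"
  proof -
    interpret prob_space ?M by (rule prob_space_normal_density) auto
    show ?thesis by (intro integrable_const_bound[where B = 1]) auto
  qed
  have "(CLINT x|?M. iexp (t * x)) = exp (- (t^2) / 2)"
    using char_std_normal_distribution by (simp add: char_def fun_eq_iff)
  then have "has_bochner_integral ?M (\<lambda>x. iexp (t * x)) (of_real (exp (- (t^2) / 2)))"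
    using int by (simp add: has_bochner_integral_iff)
  then have "has_bochner_integral ?M (\<lambda>x. Re (iexp (t * x))) (Re (of_real (exp (- (t^2) / 2))))"
    by (rule has_bochner_integral_Re)
  then have "has_bochner_integral ?M (\<lambda>x. cos (t * x)) (exp (- (t^2) / 2))"
    by (simp add: Re_exp)
  then have "has_bochner_integral lborel (\<lambda>x. std_normal_density x * cos (t * x)) (exp (- (t^2) / 2))"
    by (simp add: has_bochner_integral_iff integrable_density integral_density normal_density_nonneg)
  then have "has_bochner_integral lborel (\<lambda>x. std_normal_density (0 + s * x) * cos (t * (0 + s * x)))
               (exp (- (t^2) / 2) /\<^sub>R \<bar>s\<bar>)"
    by (rule iffD1[OF lborel_has_bochner_integral_real_affine_iff, rotated]) (use s in auto)
  also have "exp (- (t^2) / 2) /\<^sub>R \<bar>s\<bar> = exp (- (t^2) / 2) / \<bar>s\<bar>"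
    by (simp only: real_scaleR_def divide_inverse mult.commute)
  finally have "has_bochner_integral lborel (\<lambda>x. std_normal_density (0 + s * x) * cos (t * (0 + s * x)))
               (exp (- (t^2) / 2) / \<bar>s\<bar>)" .
  then have "has_bochner_integral lborel
      (\<lambda>x. sqrt (2 * pi) * (std_normal_density (0 + s * x) * cos (t * (0 + s * x))))
      (sqrt (2 * pi) * (exp (- (t^2) / 2) / \<bar>s\<bar>))"
    by (rule has_bochner_integral_mult_right)
  moreover have "sqrt (2 * pi) * (std_normal_density (0 + s * x) * cos (t * (0 + s * x))) =
                   exp (- pi * a * x ^ 2) * cos (2 * pi * \<xi> * x)" for x
    using s by (simp add: std_normal_density_def t_def power_mult_distrib) (simp only: mult.assoc)
  moreover have "sqrt (2 * pi) * (exp (- (t^2) / 2) / \<bar>s\<bar>) = exp (- pi * \<xi> ^ 2 / a) / sqrt a"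
  proof -
    have "t ^ 2 / 2 = pi * \<xi> ^ 2 / a"
      using assms s by (simp add: t_def power_divide power_mult_distrib power2_eq_square)
    then show ?thesis using s(1) by (simp add: s_def real_sqrt_mult)
  qed
  ultimately show ?thesis by simp
qed

text \<open>
  Unfolding a periodization: the integrals over the unit intervals \<open>[n, n + 1]\<close> add up to the
  integral over the line. Summability over the integers being given, it is enough to follow the
  partial sums over \<open>- M \<le> n < M\<close>.
\<close>

lemma integral_unit_intervals_has_sum:
  fixes \<phi> :: "real \<Rightarrow> real"
  assumes "has_bochner_integral lborel \<phi> I" and "continuous_on UNIV \<phi>"
    and "(\<lambda>n::int. integral {0..1} (\<lambda>x. \<phi> (x + n))) summable_on UNIV"
  shows "((\<lambda>n::int. integral {0..1} (\<lambda>x. \<phi> (x + n))) has_sum I) UNIV"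
proof -
  have cont: "continuous_on S \<phi>" for S
    using assms(2) continuous_on_subset by blast
  define J where "J n = integral {0..1} (\<lambda>x. \<phi> (x + real_of_int n))" for n
  obtain S where S: "(J has_sum S) UNIV"
    using assms(3) unfolding J_def summable_on_def by blast
  define F where "F M = {- int M..<int M}" for M
  have "filterlim F (finite_subsets_at_top UNIV) sequentially"
    unfolding filterlim_finite_subsets_at_top
  proof safe
    fix X :: "int set" assume X: "finite X"
    obtain B where B: "\<And>x. x \<in> X \<Longrightarrow> \<bar>x\<bar> < B"
    proof
      show "\<bar>x\<bar> < Max (abs ` X) + 1" if "x \<in> X" for x
        using Max_ge[of "abs ` X" "\<bar>x\<bar>"] X that by simp
    qed
    show "\<forall>\<^sub>F M in sequentially. finite (F M) \<and> X \<subseteq> F M \<and> F M \<subseteq> UNIV"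
      using eventually_ge_at_top[of "nat B"]
    proof eventually_elim
      case (elim M)
      then show ?case using B by (force simp: F_def)
    qed
  qed
  then have lim1: "(\<lambda>M. sum J (F M)) \<longlonglongrightarrow> S"
    using S unfolding has_sum_def by (rule filterlim_compose[rotated])
  have J: "J n = integral {real_of_int n..real_of_int n + 1} \<phi>" for n
    using integral_shift_real_ivl[of "real_of_int n" "real_of_int n" "real_of_int n + 1" \<phi>]
    by (simp add: J_def)
  have "sum J (F M) = integral {- real M..real M} \<phi>" for M
  proof (induction M)
    case (Suc M)
    have "F (Suc M) = insert (int M) (insert (- int M - 1) (F M))"
      by (auto simp: F_def)
    then have "sum J (F (Suc M)) = J (- int M - 1) + sum J (F M) + J (int M)"
      by (simp add: F_def)
    also have "\<dots> = integral {- real M - 1..- real M} \<phi> + integral {- real M..real M} \<phi> +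
                     integral {real M..real M + 1} \<phi>"
      using Suc by (simp add: J)
    also have "\<dots> = integral {- real M - 1..real M + 1} \<phi>"
      by (simp add: Henstock_Kurzweil_Integration.integral_combine integrable_continuous_real cont)
    also have "- real M - 1 = - real (Suc M)" by simp
    also have "real M + 1 = real (Suc M)" by simp
    finally show ?case .
  qed (simp add: F_def)
  then have lim1: "(\<lambda>M. integral {- real M..real M} \<phi>) \<longlonglongrightarrow> S"
    using lim1 by simp
  have "(\<lambda>M. LINT x|lborel. indicator {- real M..real M} x *\<^sub>R \<phi> x) \<longlonglongrightarrow> (LINT x|lborel. \<phi> x)"
  proof (rule integral_dominated_convergence[where w = "\<lambda>x. norm (\<phi> x)"])
    show "AE x in lborel. (\<lambda>M. indicator {- real M..real M} x *\<^sub>R \<phi> x) \<longlonglongrightarrow> \<phi> x"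
    proof (intro AE_I2 tendsto_eventually)
      fix x :: real
      show "\<forall>\<^sub>F M in sequentially. indicator {- real M..real M} x *\<^sub>R \<phi> x = \<phi> x"
        using eventually_ge_at_top[of "nat \<lceil>\<bar>x\<bar>\<rceil>"]
        by eventually_elim (auto simp: indicator_def; linarith)
    qed
    show "integrable lborel (\<lambda>x. norm (\<phi> x))" "\<phi> \<in> borel_measurable lborel"
      using assms(1) by (auto simp: has_bochner_integral_iff)
    then show "(\<lambda>x. indicator {- real M..real M} x *\<^sub>R \<phi> x) \<in> borel_measurable lborel" for M
      by measurable
  qed (auto simp: indicator_def)
  moreover have "(LINT x|lborel. indicator {- real M..real M} x *\<^sub>R \<phi> x) = integral {- real M..real M} \<phi>" for M
    using set_borel_integral_eq_integral(2)[of "{- real M..real M}" \<phi>]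
      borel_integrable_atLeastAtMost'[OF cont]
    by (simp add: set_lebesgue_integral_def)
  ultimately have "(\<lambda>M. integral {- real M..real M} \<phi>) \<longlonglongrightarrow> I"
    using assms(1) by (simp add: has_bochner_integral_iff)
  then have "S = I" using lim1 LIMSEQ_unique by blast
  then show ?thesis using S by (simp add: J_def[abs_def])
qed

definition gauss_periodization :: "real \<Rightarrow> real \<Rightarrow> real" where
  "gauss_periodization lam x = sqrt lam * (\<Sum>\<^sub>\<infinity>n::int. exp (- (pi * lam) * (x + of_int n) ^ 2))"

text \<open>
  The coefficients are even in \<open>n\<close>, so the sine parts cancel and the theta value is real.
\<close>

lemma theta3_eq_cos_series:
  fixes lam x :: real
  assumes "lam > 0"
  shows "theta3 (of_real x) (\<i> * of_real (inverse lam)) =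
           of_real (\<Sum>\<^sub>\<infinity>n::int. exp (- (pi / lam) * of_int n ^ 2) * cos (2 * pi * of_int n * x))"
proof -
  define b where "b n = exp (- (pi / lam) * real_of_int n ^ 2)" for n
  define t where "t n = of_real (b n) * cis (2 * pi * of_int n * x)" for n
  have b: "b summable_on UNIV"
    unfolding b_def using assms by (intro summable_on_gaussian) auto
  have "exp (of_real pi * \<i> * (\<i> * of_real (inverse lam)) * of_int n ^ 2) * e2pi (of_int n * of_real x) = t n"
    for n
  proof -
    have "of_real pi * \<i> * (\<i> * of_real (inverse lam)) * of_int n ^ 2 =
            (\<i> * \<i>) * complex_of_real (pi * inverse lam * of_int n ^ 2)"
      by (simp add: mult_ac)
    also have "\<dots> = complex_of_real (- (pi / lam) * of_int n ^ 2)"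
      by (simp add: divide_inverse)
    finally have "of_real pi * \<i> * (\<i> * of_real (inverse lam)) * of_int n ^ 2 =
            complex_of_real (- (pi / lam) * of_int n ^ 2)" .
    moreover have "e2pi (of_int n * of_real x) = cis (2 * pi * of_int n * x)"
      by (simp add: e2pi_def cis_conv_exp mult_ac)
    ultimately show ?thesis
      by (simp only: t_def b_def exp_of_real)
  qed
  then have th: "theta3 (of_real x) (\<i> * of_real (inverse lam)) = infsum t UNIV"
    by (simp add: theta3_def)
  have "norm (t n) = b n" for n
    by (simp add: t_def norm_mult b_def)
  then have "(\<lambda>n. norm (t n)) summable_on UNIV"
    using b by simp
  then have t: "(t has_sum infsum t UNIV) UNIV"
    using abs_summable_summable has_sum_infsum by blast
  have "((\<lambda>n. b n * sin (2 * pi * of_int n * x)) has_sum Im (infsum t UNIV)) UNIV"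
    using has_sum_Im[OF t] by (simp add: t_def)
  moreover from this have "((\<lambda>n. b (- n) * sin (2 * pi * of_int (- n) * x)) has_sum Im (infsum t UNIV)) UNIV"
    by (subst has_sum_reindex_bij_betw[where g = uminus and f = "\<lambda>n. b n * sin (2 * pi * of_int n * x)"])
       (auto intro: bij_uminus)
  then have "((\<lambda>n. - (b n * sin (2 * pi * of_int n * x))) has_sum Im (infsum t UNIV)) UNIV"
    by (simp add: b_def)
  then have "((\<lambda>n. b n * sin (2 * pi * of_int n * x)) has_sum - Im (infsum t UNIV)) UNIV"
    by (simp add: has_sum_uminus)
  ultimately have "Im (infsum t UNIV) = - Im (infsum t UNIV)"
    by (rule has_sum_unique)
  moreover have "((\<lambda>n. b n * cos (2 * pi * of_int n * x)) has_sum Re (infsum t UNIV)) UNIV"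
    using has_sum_Re[OF t] by (simp add: t_def)
  ultimately show ?thesis
    unfolding th by (auto simp: complex_eq_iff b_def infsumI)
qed

lemma
  assumes "lam > 0"
  shows continuous_on_gauss_periodization: "continuous_on UNIV (gauss_periodization lam)"
    and gauss_periodization_plus_1: "gauss_periodization lam (x + 1) = gauss_periodization lam x"
    and gauss_periodization_minus: "gauss_periodization lam (- x) = gauss_periodization lam x"
proof -
  have "continuous_on {-R<..<R} (gauss_periodization lam)" for R
    unfolding gauss_periodization_def
  proof (intro continuous_on_mult continuous_on_const continuous_on_infsum)
    show "norm (exp (- (pi * lam) * (x + real_of_int n) ^ 2)) \<le>
        (2 + 2 / (pi * lam)) * exp (pi * lam * R ^ 2 / 2) * exp (- (pi * lam / 4) * real_of_int n ^ 2)"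
      if "x \<in> {-R<..<R}" for x n
      using shifted_gaussian_le_majorant[of "pi * lam" x R n] assms that by auto
    show "(\<lambda>n::int. (2 + 2 / (pi * lam)) * exp (pi * lam * R ^ 2 / 2) *
            exp (- (pi * lam / 4) * real_of_int n ^ 2)) summable_on UNIV"
      by (rule summable_on_gaussian_majorant) (use assms in auto)
  qed (auto intro!: continuous_intros)
  then have "isCont (gauss_periodization lam) x" for x
    by (rule continuous_on_interior[of "{-(\<bar>x\<bar>+1)<..<\<bar>x\<bar>+1}"]) (auto simp: interior_open abs_less_iff; linarith)
  then show "continuous_on UNIV (gauss_periodization lam)"
    by (simp add: continuous_at_imp_continuous_on)
  show "gauss_periodization lam (x + 1) = gauss_periodization lam x"
    unfolding gauss_periodization_def
    using infsum_reindex_bij_betw[of "\<lambda>n::int. n + 1" UNIV UNIV "\<lambda>n. exp (- (pi * lam) * (x + of_int n) ^ 2)"]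
    by (simp add: bij_plus_right add_ac)
  have "(- x + real_of_int n) ^ 2 = (x + real_of_int (- n)) ^ 2" for n
    by (simp add: power2_eq_square algebra_simps)
  then show "gauss_periodization lam (- x) = gauss_periodization lam x"
    unfolding gauss_periodization_def
    using infsum_reindex_bij_betw[of "\<lambda>n::int. - n" UNIV UNIV "\<lambda>n. exp (- (pi * lam) * (x + of_int n) ^ 2)"]
    by (simp add: bij_uminus)
qed

text \<open>
  A cosine of integer frequency has period 1, so it can be moved under the periodization, and the
  integral over one period unfolds to an integral over the line.
\<close>

lemma gauss_periodization_moment:
  fixes k :: int
  assumes "lam > 0"
  shows "integral {0..1} (\<lambda>x. gauss_periodization lam x * cos (2 * pi * k * x)) =
           exp (- (pi / lam) * of_int k ^ 2)"
proof -
  define \<phi> where "\<phi> = (\<lambda>x. exp (- (pi * lam) * x ^ 2) * cos (2 * pi * k * x))"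
  have cont: "continuous_on S (\<lambda>x. \<phi> (x + c))" for S c
    unfolding \<phi>_def by (intro continuous_intros)
  have cos: "cos (2 * pi * k * (x + of_int n)) = cos (2 * pi * k * x)" for x and n :: int
  proof -
    have "cos (2 * pi * k * x + 2 * pi * of_int (k * n)) = cos (2 * pi * k * x)"
      by (simp add: cos_add sin_int_2pin cos_int_2pin del: of_int_mult)
    then show ?thesis by (simp add: algebra_simps)
  qed
  have eq: "gauss_periodization lam x * cos (2 * pi * k * x) = sqrt lam * (\<Sum>\<^sub>\<infinity>n::int. \<phi> (x + of_int n))" for x
    unfolding gauss_periodization_def \<phi>_def cos by (simp only: infsum_cmult_left' mult.assoc)
  have "((\<lambda>n. integral {0..1} (\<lambda>x. \<phi> (x + of_int n))) has_sum
          integral {0..1} (\<lambda>x. \<Sum>\<^sub>\<infinity>n::int. \<phi> (x + of_int n))) UNIV"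
  proof (rule has_sum_integral_of_majorant)
    show "\<bar>\<phi> (x + of_int n)\<bar> \<le>
        (2 + 2 / (pi * lam)) * exp (pi * lam * 1 ^ 2 / 2) * exp (- (pi * lam / 4) * real_of_int n ^ 2)"
      if "x \<in> {0..1}" for x and n :: int
    proof -
      have "\<bar>\<phi> (x + of_int n)\<bar> \<le> exp (- (pi * lam) * (x + of_int n) ^ 2) * 1"
        unfolding \<phi>_def abs_mult by (intro mult_mono) auto
      then show ?thesis
        using shifted_gaussian_le_majorant[of "pi * lam" x 1 n] assms that by auto
    qed
    show "(\<lambda>n::int. (2 + 2 / (pi * lam)) * exp (pi * lam * 1 ^ 2 / 2) *
            exp (- (pi * lam / 4) * real_of_int n ^ 2)) summable_on UNIV"
      by (rule summable_on_gaussian_majorant) (use assms in auto)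
  qed (rule cont)
  moreover have "has_bochner_integral lborel \<phi> (exp (- (pi / lam) * of_int k ^ 2) / sqrt lam)"
    using gaussian_cos_transform[OF assms, of k] by (simp add: \<phi>_def mult_ac)
  then have "((\<lambda>n. integral {0..1} (\<lambda>x. \<phi> (x + of_int n))) has_sum
               exp (- (pi / lam) * of_int k ^ 2) / sqrt lam) UNIV"
    by (rule integral_unit_intervals_has_sum) (use cont[of _ 0] calculation in \<open>auto simp: summable_on_def\<close>)
  ultimately have "integral {0..1} (\<lambda>x. \<Sum>\<^sub>\<infinity>n::int. \<phi> (x + of_int n)) =
                     exp (- (pi / lam) * of_int k ^ 2) / sqrt lam"
    by (rule has_sum_unique)
  then show ?thesis using assms by (simp add: eq)
qed

lemma cos_series_moment:
  fixes b :: "int \<Rightarrow> real" and k :: int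
  assumes "b summable_on UNIV" "\<And>n. b n \<ge> 0" "\<And>n. b (- n) = b n"
  shows "integral {0..1} (\<lambda>x. (\<Sum>\<^sub>\<infinity>n. b n * cos (2 * pi * of_int n * x)) * cos (2 * pi * k * x)) = b k"
proof -
  let ?u = "\<lambda>(n::int) x. b n * cos (2 * pi * of_int n * x) * cos (2 * pi * k * x)"
  have "((\<lambda>n. integral {0..1} (?u n)) has_sum integral {0..1} (\<lambda>x. \<Sum>\<^sub>\<infinity>n. ?u n x)) UNIV"
  proof (rule has_sum_integral_of_majorant[OF _ _ assms(1)])
    show "\<bar>?u n x\<bar> \<le> b n" for n x
    proof -
      have "\<bar>cos (2 * pi * of_int n * x) * cos (2 * pi * k * x)\<bar> \<le> 1 * 1"
        unfolding abs_mult by (intro mult_mono) auto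
      then show ?thesis
        using assms(2)[of n] mult_left_mono[of _ 1 "b n"] by (simp add: abs_mult mult.assoc)
    qed
  qed (intro continuous_intros)
  moreover have "integral {0..1} (?u n) = b n / 2 * of_bool (n + k = 0) + b n / 2 * of_bool (n - k = 0)" for n
  proof (rule integral_unique)
    have "((\<lambda>x. b n / 2 * cos (2 * pi * of_int (n + k) * x) + b n / 2 * cos (2 * pi * of_int (n - k) * x))
             has_integral (b n / 2 * of_bool (n + k = 0) + b n / 2 * of_bool (n - k = 0))) {0..1}"
      by (intro has_integral_add has_integral_mult_right has_integral_cos_period)
    moreover have "b n / 2 * cos (2 * pi * of_int (n + k) * x) + b n / 2 * cos (2 * pi * of_int (n - k) * x) = ?u n x" for x
    proof -
      have "cos (2 * pi * of_int (n + k) * x) + cos (2 * pi * of_int (n - k) * x) =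
              2 * (cos (2 * pi * of_int n * x) * cos (2 * pi * k * x))"
        using cos_add[of "2 * pi * n * x" "2 * pi * k * x"] cos_diff[of "2 * pi * n * x" "2 * pi * k * x"]
        by (simp add: algebra_simps)
      then show ?thesis by (simp only: distrib_left[symmetric])
    qed
    ultimately show "(?u n has_integral (b n / 2 * of_bool (n + k = 0) + b n / 2 * of_bool (n - k = 0))) {0..1}"
      by simp
  qed
  moreover have "((\<lambda>n. b n / 2 * of_bool (n + k = 0) + b n / 2 * of_bool (n - k = 0)) has_sum b k) UNIV"
  proof (rule has_sum_finite_neutralI[of "{k, - k}"])
    show "b k = (\<Sum>n\<in>{k, - k}. b n / 2 * of_bool (n + k = 0) + b n / 2 * of_bool (n - k = 0))"
      using assms(3)[of k] by (cases "k = 0") auto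
  qed auto
  ultimately have "integral {0..1} (\<lambda>x. \<Sum>\<^sub>\<infinity>n. ?u n x) = b k"
    using has_sum_unique by fastforce
  then show ?thesis by (simp add: infsum_cmult_left')
qed

text \<open>
  Both sides are even, continuous and of period 1, and both have the cosine moments
  \<open>exp (- pi * k\<^sup>2 / lam)\<close>: on the left these are read off the series, on the right they are values of the
  Fourier transform of the Gaussian. This is the modular inversion of the theta function.
\<close>

lemma theta3_eq_gauss_periodization:
  assumes "lam > 0"
  shows "theta3 (of_real x) (\<i> * of_real (inverse lam)) = of_real (gauss_periodization lam x)"
proof -
  define b where "b n = exp (- (pi / lam) * real_of_int n ^ 2)" for n
  have b: "b summable_on UNIV" "\<And>n. b n \<ge> 0" "\<And>n. b (- n) = b n"
    unfolding b_def by (rule summable_on_gaussian) (use assms in auto)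
  define F where "F x = (\<Sum>\<^sub>\<infinity>n. b n * cos (2 * pi * of_int n * x))" for x
  define P where "P = gauss_periodization lam"
  have contF: "continuous_on S F" for S
    unfolding F_def
    by (rule continuous_on_infsum[OF _ _ b(1)])
       (auto intro!: continuous_intros simp: abs_mult b(2) mult_left_le)
  have contP: "continuous_on S P" for S
    using continuous_on_gauss_periodization[OF assms] continuous_on_subset by (auto simp: P_def)
  have "F x - P x = 0"
  proof (rule even_periodic_eq_0_if_cos_moments_0[where h = "\<lambda>x. F x - P x"])
    show "continuous_on UNIV (\<lambda>x. F x - P x)"
      by (intro continuous_intros contF contP)
    fix x
    have "cos (2 * pi * of_int n * (x + 1)) = cos (2 * pi * of_int n * x)" for n
      using cos_int_2pin[of n] sin_int_2pin[of n] by (simp add: distrib_left cos_add)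
    then show "F (x + 1) - P (x + 1) = F x - P x"
      using gauss_periodization_plus_1[OF assms] by (simp add: F_def P_def)
    show "F (- x) - P (- x) = F x - P x"
      using gauss_periodization_minus[OF assms] by (simp add: F_def P_def)
  next
    fix k :: int
    have "integral {0..1} (\<lambda>x. (F x - P x) * cos (2 * pi * k * x)) =
        integral {0..1} (\<lambda>x. F x * cos (2 * pi * k * x)) - integral {0..1} (\<lambda>x. P x * cos (2 * pi * k * x))"
      unfolding left_diff_distrib
      by (rule integral_diff) (intro integrable_continuous_real continuous_intros contF contP)+
    also have "\<dots> = 0"
      using cos_series_moment[OF b, of k] gauss_periodization_moment[OF assms, of k]
      by (simp add: F_def P_def b_def)
    finally show "integral {0..1} (\<lambda>x. (F x - P x) * cos (2 * pi * k * x)) = 0" .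
  qed
  then show ?thesis
    using theta3_eq_cos_series[OF assms, of x] by (simp add: F_def P_def b_def)
qed

section \<open>Sampling and differentiating the periodized Gaussian\<close>

text \<open>
  This regrouping carries both the average of the periodized Gaussian over the nodes and the
  collection of the interpolation points into periods.
\<close>

lemma has_sum_residue_classes:
  fixes f :: "int \<Rightarrow> 'a :: {topological_comm_monoid_add}"
  assumes "K > 0" and "\<And>j. j < K \<Longrightarrow> ((\<lambda>p. f (int j + int K * p)) has_sum S j) UNIV"
  shows "(f has_sum (\<Sum>j<K. S j)) UNIV"
proof -
  let ?B = "\<lambda>j. range (\<lambda>p. int j + int K * p)"
  have "(f has_sum (\<Sum>j<K. S j)) (\<Union>j\<in>{..<K}. ?B j)"
  proof (rule sum_has_sum)
    fix j assume "j \<in> {..<K}"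
    then show "(f has_sum S j) (?B j)"
      using assms by (subst has_sum_reindex) (auto simp: o_def inj_on_def)
  next
    fix j j' assume jj: "j \<in> {..<K}" "j' \<in> {..<K}" "j \<noteq> j'"
    have "x mod int K = int i" if "x \<in> ?B i" "i < K" for x i
      using that by auto
    then show "?B j \<inter> ?B j' = {}"
      using jj by fastforce
  qed auto
  moreover have "(\<Union>j\<in>{..<K}. ?B j) = UNIV"
  proof -
    have "m \<in> ?B (nat (m mod int K)) \<and> nat (m mod int K) < K" for m
      using assms(1) by (auto simp: image_iff nat_less_iff intro!: exI[of _ "m div int K"])
    then show ?thesis by blast
  qed
  ultimately show ?thesis by simp
qed

text \<open>
  The points \<open>(j + c) / K + n\<close> with \<open>j < K\<close> and \<open>n\<close> an integer are exactly the points \<open>(c + m) / K\<close>, each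
  occurring once.
\<close>

lemma average_gauss_periodization:
  assumes "lam > 0" "K > 0"
  shows "(\<Sum>j<K. gauss_periodization lam ((real j + c) / real K)) / real K =
           gauss_periodization (lam / real K ^ 2) c"
proof -
  define f where "f m = exp (- (pi * (lam / real K ^ 2)) * (c + real_of_int m) ^ 2)" for m
  define S where "S j = (\<Sum>\<^sub>\<infinity>n::int. exp (- (pi * lam) * ((real j + c) / real K + of_int n) ^ 2))" for j
  have "(f has_sum (\<Sum>j<K. S j)) UNIV"
  proof (rule has_sum_residue_classes[OF assms(2)])
    fix j assume "j < K"
    have "f (int j + int K * p) = exp (- (pi * lam) * ((real j + c) / real K + of_int p) ^ 2)" for p
    proof -
      have "c + real_of_int (int j + int K * p) = real K * ((real j + c) / real K + of_int p)"
        using assms(2) by (simp add: field_simps)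
      then show ?thesis using assms(2) by (simp only: f_def power_mult_distrib) simp
    qed
    then show "((\<lambda>p. f (int j + int K * p)) has_sum S j) UNIV"
      unfolding S_def using summable_on_shifted_gaussian(1)[of "pi * lam"] assms
      by (simp add: has_sum_infsum)
  qed
  then have "infsum f UNIV = (\<Sum>j<K. S j)"
    by (rule infsumI)
  then show ?thesis
    unfolding gauss_periodization_def S_def[symmetric] f_def[symmetric] sum_distrib_left[symmetric]
    by (simp add: real_sqrt_divide)
qed

text \<open>
  A shift by a half period produces the alternating signs, which brings both bounds under a
  single formula in the shift \<open>c\<close>.
\<close>

lemma theta3_half_eq_theta2: "theta2 0 \<tau> = theta3 (of_real (1 / 2)) \<tau>"
proof -
  have "e2pi (of_int n * of_real (1 / 2)) = (-1) powi n" for n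
  proof -
    have "e2pi (of_int n * of_real (1 / 2)) = cis (pi * n)"
      by (simp add: e2pi_def cis_conv_exp mult_ac)
    also have "\<dots> = (-1) powi n"
      by (metis cis_pi cis_power_int mult.commute)
    finally show ?thesis .
  qed
  moreover have "e2pi (of_int n * 0) = 1" for n
    by (simp add: e2pi_def)
  ultimately show ?thesis
    unfolding theta2_def theta3_def by (simp add: mult_ac)
qed

definition gauss_periodization_deriv :: "real \<Rightarrow> real \<Rightarrow> real" where
  "gauss_periodization_deriv lam x =
     sqrt lam * (\<Sum>\<^sub>\<infinity>n::int. - (2 * pi * lam) * (x + of_int n) * exp (- (pi * lam) * (x + of_int n) ^ 2))"

text \<open>
  Termwise differentiation, justified by the weighted majorant; enumerating the integers by
  \<open>int_decode\<close> reduces it to a series over the natural numbers.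
\<close>

lemma has_derivative_gauss_periodization:
  assumes "lam > 0"
  shows "(gauss_periodization lam has_real_derivative gauss_periodization_deriv lam x) (at x)"
proof -
  define a where "a = pi * lam"
  have a: "a > 0" using assms by (simp add: a_def)
  define R where "R = \<bar>x\<bar> + 1"
  define M where "M n = (2 + 2 / a) * exp (a * R ^ 2 / 2) * exp (- (a / 4) * real_of_int n ^ 2)" for n
  define u where "u k y = exp (- a * (y + of_int (int_decode k)) ^ 2)" for k and y :: real
  define u' where "u' k y = - (2 * a) * (y + of_int (int_decode k)) * exp (- a * (y + of_int (int_decode k)) ^ 2)"
    for k and y :: real
  have "(\<lambda>n. 2 * a * M n) summable_on UNIV"
    unfolding M_def using a by (intro summable_on_cmult_right summable_on_gaussian_majorant)
  then have "(\<lambda>k. 2 * a * M (int_decode k)) summable_on UNIV"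
    using summable_on_reindex_bij_betw[OF bij_int_decode, of "\<lambda>n. 2 * a * M n"] by simp
  then have sM: "summable (\<lambda>k. 2 * a * M (int_decode k))"
    by (rule summable_on_imp_summable)
  have x: "x \<in> {-R<..<R}" by (auto simp: R_def)
  have su: "((\<lambda>n. exp (- a * (y + real_of_int n) ^ 2)) \<circ> int_decode) summable_on UNIV" 
    "((\<lambda>n. - (2 * a) * (y + of_int n) * exp (- a * (y + of_int n) ^ 2)) \<circ> int_decode) summable_on UNIV" for y
  proof -
    have "(\<lambda>n. - (2 * a) * ((y + of_int n) * exp (- a * (y + of_int n) ^ 2))) summable_on UNIV"
      by (intro summable_on_cmult_right summable_on_shifted_gaussian(2) a)
    then show "((\<lambda>n. - (2 * a) * (y + of_int n) * exp (- a * (y + of_int n) ^ 2)) \<circ> int_decode) summable_on UNIV"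
      by (subst summable_on_reindex[symmetric])
         (use bij_int_decode in \<open>auto simp: bij_betw_def mult.assoc\<close>)
    show "((\<lambda>n. exp (- a * (y + real_of_int n) ^ 2)) \<circ> int_decode) summable_on UNIV"
      by (subst summable_on_reindex[symmetric])
         (use bij_int_decode summable_on_shifted_gaussian(1)[OF a, of y] in \<open>auto simp: bij_betw_def\<close>)
  qed
  have "((\<lambda>y. \<Sum>k. u k y) has_real_derivative (\<Sum>k. u' k x)) (at x)"
  proof (rule has_field_derivative_series'(2)[of "{-R<..<R}" _ _ x])
    show "(u k has_real_derivative u' k y) (at y within {-R<..<R})" for k y
      unfolding u_def u'_def by (auto intro!: derivative_eq_intros)
    show "uniformly_convergent_on {-R<..<R} (\<lambda>n y. \<Sum>i<n. u' i y)"
    proof (rule Weierstrass_m_test'[OF _ sM])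
      fix k y assume y: "y \<in> {-R<..<R}"
      have "\<bar>y + of_int (int_decode k)\<bar> * exp (- a * (y + of_int (int_decode k)) ^ 2) \<le> M (int_decode k)"
      proof -
        have "\<bar>y + of_int (int_decode k)\<bar> * exp (- a * (y + of_int (int_decode k)) ^ 2) \<le>
              (1 + \<bar>y + of_int (int_decode k)\<bar>) * exp (- a * (y + of_int (int_decode k)) ^ 2)"
          by (intro mult_right_mono) auto
        also have "\<dots> \<le> M (int_decode k)"
          unfolding M_def using y by (intro weighted_shifted_gaussian_le_majorant a) auto
        finally show ?thesis .
      qed
      then have "2 * a * (\<bar>y + of_int (int_decode k)\<bar> * exp (- a * (y + of_int (int_decode k)) ^ 2)) \<le>
                   2 * a * M (int_decode k)"
        using a by (intro mult_left_mono) auto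
      then show "norm (u' k y) \<le> 2 * a * M (int_decode k)"
        using a by (simp add: u'_def abs_mult mult.assoc)
    qed
    show "summable (\<lambda>k. u k x)"
      using summable_on_imp_summable[OF su(1)[of x]] by (simp add: u_def[abs_def] o_def)
  qed (use x in \<open>auto simp: interior_open\<close>)
  moreover have "(\<Sum>k. u k y) = (\<Sum>\<^sub>\<infinity>n::int. exp (- a * (y + of_int n) ^ 2))" for y
    using sums_unique[OF has_sum_imp_sums[OF has_sum_infsum[OF su(1)[of y]]]]
      infsum_reindex_bij_betw[OF bij_int_decode, of "\<lambda>n. exp (- a * (y + of_int n) ^ 2)"]
    by (simp add: u_def o_def)
  moreover have "(\<Sum>k. u' k x) = (\<Sum>\<^sub>\<infinity>n::int. - (2 * a) * (x + of_int n) * exp (- a * (x + of_int n) ^ 2))"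
    using sums_unique[OF has_sum_imp_sums[OF has_sum_infsum[OF su(2)[of x]]]]
      infsum_reindex_bij_betw[OF bij_int_decode, of "\<lambda>n. - (2 * a) * (x + of_int n) * exp (- a * (x + of_int n) ^ 2)"]
    by (simp add: u'_def o_def)
  ultimately have "((\<lambda>y. \<Sum>\<^sub>\<infinity>n::int. exp (- a * (y + of_int n) ^ 2)) has_real_derivative
      (\<Sum>\<^sub>\<infinity>n::int. - (2 * a) * (x + of_int n) * exp (- a * (x + of_int n) ^ 2))) (at x)"
    by simp
  then show ?thesis
    unfolding gauss_periodization_def gauss_periodization_deriv_def a_def[symmetric]
    by (intro DERIV_cmult) (simp add: a_def mult.assoc)
qed

section \<open>Hermite interpolation by trigonometric polynomials\<close>

lemma e2pi_add: "e2pi (x + y) = e2pi x * e2pi y"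
  by (simp add: e2pi_def exp_add distrib_left)

lemma e2pi_nonzero [simp]: "e2pi x \<noteq> 0"
  by (simp add: e2pi_def)

lemma e2pi_of_nat_mult: "e2pi (of_nat n * x) = e2pi x ^ n"
  by (simp add: e2pi_def exp_of_nat_mult[symmetric] mult_ac)

lemma e2pi_of_int_mult: "e2pi (of_int n * x) = e2pi x powi n"
  unfolding e2pi_def exp_power_int by (simp add: mult_ac)

lemma e2pi_of_int [simp]: "e2pi (of_int n) = 1"
  using e2pi_of_int_mult[of n 1] by (simp add: e2pi_def)

lemma e2pi_eq_1_iff: "e2pi (of_real x) = 1 \<longleftrightarrow> x \<in> \<int>"
proof
  assume "e2pi (of_real x) = 1"
  then obtain n :: int where "2 * pi * x = of_int (2 * n) * pi"
    by (auto simp: e2pi_def exp_eq_1)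
  then have "x = of_int n" by simp
  then show "x \<in> \<int>" by simp
next
  assume "x \<in> \<int>"
  then show "e2pi (of_real x) = 1" by (auto elim!: Ints_cases)
qed

lemma sum_e2pi_nodes:
  assumes "K > 0"
  shows "(\<Sum>j<K. e2pi (of_int n * of_real ((real j + c) / real K))) =
           (if int K dvd n then of_nat K * e2pi (of_int n * of_real (c / real K)) else 0)"
proof -
  define r where "r = e2pi (of_real (of_int n / real K))"
  have node: "e2pi (of_int n * of_real ((real j + c) / real K)) = e2pi (of_int n * of_real (c / real K)) * r ^ j" for j
    unfolding r_def e2pi_of_nat_mult[symmetric] e2pi_add[symmetric]
    by (simp add: algebra_simps add_divide_distrib)
  have "of_int n / real K \<in> \<int> \<longleftrightarrow> int K dvd n"
  proof
    assume "of_int n / real K \<in> \<int>"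
    then obtain m where "of_int n / real K = of_int m" by (auto elim: Ints_cases)
    then have "real_of_int n = of_int (int K * m)" using assms by (simp add: field_simps)
    then have "n = int K * m" by (simp only: of_int_eq_iff)
    then show "int K dvd n" by simp
  qed (use assms in \<open>auto elim!: dvdE\<close>)
  then have r1: "r = 1 \<longleftrightarrow> int K dvd n"
    by (simp only: r_def e2pi_eq_1_iff)
  have "r ^ K = e2pi (of_int n)"
    using assms unfolding r_def e2pi_of_nat_mult[symmetric] by simp
  then have "r ^ K = 1" by simp
  then have "(\<Sum>j<K. r ^ j) = (if int K dvd n then of_nat K else 0)"
    using r1 by (cases "r = 1") (auto simp: geometric_sum)
  then show ?thesis
    by (simp only: node sum_distrib_left[symmetric]) simp
qed

text \<open>
  The nodes \<open>w j\<close> are thought of as all the \<open>K\<close>-th roots of \<open>\<epsilon>\<close>, which is expressed by their power sums.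
  Expanding \<open>(z\<^sup>K - \<epsilon>) / (z - w j)\<close> as a geometric sum, the sum over \<open>j\<close> retains the single term in
  which the exponent of \<open>w j\<close> equals \<open>K\<close>.
\<close>

lemma lagrange_node_sum:
  fixes w :: "nat \<Rightarrow> complex"
  assumes w: "\<And>j. j < K \<Longrightarrow> w j ^ K = \<epsilon>"
    and pow: "\<And>m. 1 \<le> m \<Longrightarrow> m < 2 * K \<Longrightarrow> (\<Sum>j<K. w j ^ m) = (if m = K then of_nat K * \<epsilon> else 0)"
    and n: "n < K" and z: "z ^ K \<noteq> \<epsilon>"
  shows "(\<Sum>j<K. w j ^ Suc n / (z - w j)) = of_nat K * \<epsilon> * z ^ n / (z ^ K - \<epsilon>)"
proof -
  have "(z ^ K - \<epsilon>) * (w j ^ Suc n / (z - w j)) = (\<Sum>i<K. z ^ i * w j ^ (n + K - i))" if "j < K" for j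
  proof -
    have "z \<noteq> w j" using w[OF that] z by auto
    moreover have "z ^ K - \<epsilon> = (z - w j) * (\<Sum>i<K. w j ^ (K - Suc i) * z ^ i)"
      using w[OF that] power_diff_sumr2[of z K "w j"] by simp
    ultimately have "(z ^ K - \<epsilon>) * (w j ^ Suc n / (z - w j)) = w j ^ Suc n * (\<Sum>i<K. w j ^ (K - Suc i) * z ^ i)"
      by simp
    also have "\<dots> = (\<Sum>i<K. z ^ i * w j ^ (n + K - i))"
      unfolding sum_distrib_left
    proof (rule sum.cong)
      fix i assume "i \<in> {..<K}"
      then have "n + K - i = Suc n + (K - Suc i)" by auto
      then show "w j ^ Suc n * (w j ^ (K - Suc i) * z ^ i) = z ^ i * w j ^ (n + K - i)"
        by (simp only: power_add mult_ac)
    qed simp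
    finally show ?thesis .
  qed
  then have "(z ^ K - \<epsilon>) * (\<Sum>j<K. w j ^ Suc n / (z - w j)) = (\<Sum>j<K. \<Sum>i<K. z ^ i * w j ^ (n + K - i))"
    by (simp add: sum_distrib_left)
  also have "\<dots> = (\<Sum>i<K. z ^ i * (\<Sum>j<K. w j ^ (n + K - i)))"
    by (subst sum.swap) (simp add: sum_distrib_left)
  also have "\<dots> = (\<Sum>i<K. if i = n then z ^ i * (of_nat K * \<epsilon>) else 0)"
  proof (rule sum.cong)
    fix i assume "i \<in> {..<K}"
    then have "(\<Sum>j<K. w j ^ (n + K - i)) = (if n + K - i = K then of_nat K * \<epsilon> else 0)"
      using n by (intro pow) auto
    moreover have "n + K - i = K \<longleftrightarrow> i = n"
      using \<open>i \<in> {..<K}\<close> by auto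
    ultimately show "z ^ i * (\<Sum>j<K. w j ^ (n + K - i)) = (if i = n then z ^ i * (of_nat K * \<epsilon>) else 0)"
      by simp
  qed simp
  also have "\<dots> = z ^ n * (of_nat K * \<epsilon>)"
    using n by simp
  finally show ?thesis
    using z by (simp add: field_simps)
qed

text \<open>
  The derivative of the preceding identity with respect to \<open>z\<close>.
\<close>

lemma lagrange_node_sum_deriv:
  fixes w :: "nat \<Rightarrow> complex"
  assumes w: "\<And>j. j < K \<Longrightarrow> w j ^ K = \<epsilon>"
    and pow: "\<And>m. 1 \<le> m \<Longrightarrow> m < 2 * K \<Longrightarrow> (\<Sum>j<K. w j ^ m) = (if m = K then of_nat K * \<epsilon> else 0)"
    and n: "n < K" and z: "z ^ K \<noteq> \<epsilon>"
  shows "z * (\<Sum>j<K. w j ^ Suc n / (z - w j) ^ 2) =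
           of_nat K * \<epsilon> * (of_nat K * z ^ (K + n) / (z ^ K - \<epsilon>) ^ 2 - of_nat n * z ^ n / (z ^ K - \<epsilon>))"
proof -
  have zw: "z - w j \<noteq> 0" if "j < K" for j using w[OF that] z by auto
  have P: "z ^ K - \<epsilon> \<noteq> 0" using z by simp
  have "((\<lambda>z. \<Sum>j<K. w j ^ Suc n / (z - w j)) has_field_derivative
           (\<Sum>j<K. - (w j ^ Suc n / (z - w j) ^ 2))) (at z)"
    using zw by (auto intro!: derivative_eq_intros sum.cong simp: power2_eq_square)
  moreover have "((\<lambda>z. \<Sum>j<K. w j ^ Suc n / (z - w j)) has_field_derivative
      of_nat K * \<epsilon> * (of_nat n * z ^ (n - 1) * (z ^ K - \<epsilon>) - z ^ n * (of_nat K * z ^ (K - 1))) / (z ^ K - \<epsilon>) ^ 2) (at z)"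
  proof (rule has_field_derivative_transform_within_open[where S = "{z. z ^ K \<noteq> \<epsilon>}"])
    show "((\<lambda>z. of_nat K * \<epsilon> * z ^ n / (z ^ K - \<epsilon>)) has_field_derivative
      of_nat K * \<epsilon> * (of_nat n * z ^ (n - 1) * (z ^ K - \<epsilon>) - z ^ n * (of_nat K * z ^ (K - 1))) / (z ^ K - \<epsilon>) ^ 2) (at z)"
      using P by (auto intro!: derivative_eq_intros simp: power2_eq_square field_simps)
    show "open {z. z ^ K \<noteq> \<epsilon>}"
      by (intro open_Collect_neq continuous_intros)
  qed (use z lagrange_node_sum[OF w pow n] in auto)
  ultimately have "(\<Sum>j<K. - (w j ^ Suc n / (z - w j) ^ 2)) =
      of_nat K * \<epsilon> * (of_nat n * z ^ (n - 1) * (z ^ K - \<epsilon>) - z ^ n * (of_nat K * z ^ (K - 1))) / (z ^ K - \<epsilon>) ^ 2"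
    by (rule DERIV_unique)
  then have "(\<Sum>j<K. w j ^ Suc n / (z - w j) ^ 2) =
      - (of_nat K * \<epsilon> * (of_nat n * z ^ (n - 1) * (z ^ K - \<epsilon>) - z ^ n * (of_nat K * z ^ (K - 1))) / (z ^ K - \<epsilon>) ^ 2)"
    unfolding sum_negf by (metis minus_minus)
  then have "z * (\<Sum>j<K. w j ^ Suc n / (z - w j) ^ 2) =
      - (of_nat K * \<epsilon> * (of_nat n * (z * z ^ (n - 1)) * (z ^ K - \<epsilon>) - z ^ n * (of_nat K * (z * z ^ (K - 1)))) / (z ^ K - \<epsilon>) ^ 2)"
    by (simp add: algebra_simps)
  also have "of_nat n * (z * z ^ (n - 1)) = of_nat n * z ^ n"
    by (cases n) auto
  also have "z * z ^ (K - 1) = z ^ K"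
    using n by (cases K) auto
  also have "- (of_nat K * \<epsilon> * (of_nat n * z ^ n * (z ^ K - \<epsilon>) - z ^ n * (of_nat K * z ^ K)) / (z ^ K - \<epsilon>) ^ 2) =
      of_nat K * \<epsilon> * (of_nat K * z ^ (K + n) / (z ^ K - \<epsilon>) ^ 2 - of_nat n * z ^ n / (z ^ K - \<epsilon>))"
  proof -
    have "- (c * (a * p - b) / p ^ 2) = c * (b / p ^ 2 - a / p)" if "p \<noteq> 0" for a b c p :: complex
      using that by (simp add: field_simps power2_eq_square)
    from this[OF P, of "of_nat K * \<epsilon>" "of_nat n * z ^ n" "z ^ n * (of_nat K * z ^ K)"]
    show ?thesis by (simp add: power_add mult_ac)
  qed
  finally show ?thesis .
qed

text \<open>
  Hermite interpolation of the monomial of exponent \<open>n\<close> in multiplicative form. The parameter \<open>s\<close>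
  is the factor contributed by differentiation; it is kept apart from \<open>n\<close> because a negative
  frequency \<open>s\<close> will be represented by the exponent \<open>n = K + s\<close>. On the right the
  simple pole cancels for \<open>s = n\<close> and merges with the double pole for \<open>s = n - K\<close>.
\<close>

lemma hermite_node_sum:
  fixes w :: "nat \<Rightarrow> complex"
  assumes w: "\<And>j. j < K \<Longrightarrow> w j ^ K = \<epsilon>"
    and pow: "\<And>m. 1 \<le> m \<Longrightarrow> m < 2 * K \<Longrightarrow> (\<Sum>j<K. w j ^ m) = (if m = K then of_nat K * \<epsilon> else 0)"
    and n: "n < K" and z: "z ^ K \<noteq> \<epsilon>" and s: "n > 0 \<or> s = 0"
  shows "(\<Sum>j<K. w j ^ n * (- 4 * z * w j / (z - w j) ^ 2 - 2 * s * ((z + w j) / (z - w j)))) =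
           - 4 * of_nat K * \<epsilon> * (of_nat K * z ^ (K + n) / (z ^ K - \<epsilon>) ^ 2 + (s - of_nat n) * z ^ n / (z ^ K - \<epsilon>))"
proof -
  have zw: "z - w j \<noteq> 0" if "j < K" for j using w[OF that] z by auto
  have L: "(\<Sum>j<K. w j ^ Suc n / (z - w j)) = of_nat K * \<epsilon> * z ^ n / (z ^ K - \<epsilon>)"
    "z * (\<Sum>j<K. w j ^ Suc n / (z - w j) ^ 2) =
       of_nat K * \<epsilon> * (of_nat K * z ^ (K + n) / (z ^ K - \<epsilon>) ^ 2 - of_nat n * z ^ n / (z ^ K - \<epsilon>))"
    by (rule lagrange_node_sum lagrange_node_sum_deriv; use w pow n z in simp)+
  have s1: "s * (\<Sum>j<K. w j ^ n) = 0"
    using s pow[of n] n by auto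
  have "w j ^ n * (- 4 * z * w j / (z - w j) ^ 2 - 2 * s * ((z + w j) / (z - w j))) =
      - 4 * (z * (w j ^ Suc n / (z - w j) ^ 2)) - 4 * s * (w j ^ Suc n / (z - w j)) - 2 * (s * w j ^ n)" if "j < K" for j
  proof -
    \<comment> \<open>This form needs only node sums with exponent \<open>n + 1\<close>, so the exponent 0 is covered.\<close>
    have "(z + w j) / (z - w j) = 1 + 2 * w j / (z - w j)"
      using zw[OF that] by (simp add: field_simps)
    then show ?thesis by (simp add: algebra_simps)
  qed
  then have "(\<Sum>j<K. w j ^ n * (- 4 * z * w j / (z - w j) ^ 2 - 2 * s * ((z + w j) / (z - w j)))) =
      (\<Sum>j<K. - 4 * (z * (w j ^ Suc n / (z - w j) ^ 2)) - 4 * s * (w j ^ Suc n / (z - w j)) - 2 * (s * w j ^ n))"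
    by (intro sum.cong) auto
  also have "\<dots> = - 4 * (z * (\<Sum>j<K. w j ^ Suc n / (z - w j) ^ 2)) - 4 * s * (\<Sum>j<K. w j ^ Suc n / (z - w j))
                   - 2 * (s * (\<Sum>j<K. w j ^ n))"
    by (simp only: sum_subtractf sum_distrib_left)
  also have "\<dots> = - 4 * of_nat K * \<epsilon> * (of_nat K * z ^ (K + n) / (z ^ K - \<epsilon>) ^ 2 + (s - of_nat n) * z ^ n / (z ^ K - \<epsilon>))"
    unfolding L s1 by (simp add: algebra_simps diff_divide_distrib add_divide_distrib)
  finally show ?thesis .
qed

text \<open>
  On the nodes the power \<open>n < 0\<close> agrees up to the factor \<open>\<epsilon>\<close> with the power \<open>K + n\<close>, so that negative
  frequencies reduce to natural exponents.
\<close>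

lemma hermite_node_sum_powi:
  fixes w :: "nat \<Rightarrow> complex" and n :: int
  assumes w: "\<And>j. j < K \<Longrightarrow> w j ^ K = \<epsilon>"
    and pow: "\<And>m. 1 \<le> m \<Longrightarrow> m < 2 * K \<Longrightarrow> (\<Sum>j<K. w j ^ m) = (if m = K then of_nat K * \<epsilon> else 0)"
    and n: "\<bar>n\<bar> < int K" and z: "z ^ K \<noteq> \<epsilon>" "z \<noteq> 0" and \<epsilon>: "\<epsilon> \<noteq> 0"
  shows "(\<Sum>j<K. w j powi n * (- 4 * z * w j / (z - w j) ^ 2 - 2 * of_int n * ((z + w j) / (z - w j)))) =
           - 4 * of_nat K ^ 2 * \<epsilon> * z ^ K * z powi n / (z ^ K - \<epsilon>) ^ 2"
proof (cases "n \<ge> 0")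
  case True
  then have "of_int n = complex_of_nat (nat n)" by simp
  moreover have "0 < n \<or> n = 0" using True by auto
  ultimately show ?thesis
    using hermite_node_sum[OF w pow _ z(1), of "nat n" "of_int n"] True n
    by (simp add: power_int_def power_add power2_eq_square mult_ac)
next
  case False
  define m where "m = nat (int K + n)"
  have m: "m < K" "m > 0" "int m = int K + n" using False n by (auto simp: m_def)
  have wn: "w j powi n = w j ^ m / \<epsilon>" if "j < K" for j
  proof -
    have "w j \<noteq> 0" using w[OF that] \<epsilon> m by auto
    then have "w j ^ m = w j ^ K * w j powi n"
      using m(3) by (metis power_int_add power_int_of_nat)
    then show ?thesis using w[OF that] \<epsilon> by simp
  qed
  have zn: "z ^ m = z ^ K * z powi n"
    using m(3) z(2) by (metis power_int_add power_int_of_nat)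
  have "(\<Sum>j<K. w j powi n * (- 4 * z * w j / (z - w j) ^ 2 - 2 * of_int n * ((z + w j) / (z - w j)))) =
      (\<Sum>j<K. w j ^ m * (- 4 * z * w j / (z - w j) ^ 2 - 2 * of_int n * ((z + w j) / (z - w j)))) / \<epsilon>"
    unfolding sum_divide_distrib by (intro sum.cong) (auto simp: wn)
  also have "\<dots> = - 4 * of_nat K * (of_nat K * z ^ (K + m) / (z ^ K - \<epsilon>) ^ 2 + (of_int n - of_nat m) * z ^ m / (z ^ K - \<epsilon>))"
    using hermite_node_sum[OF w pow m(1) z(1), of "of_int n"] m(2) \<epsilon> by simp
  also have "of_int n - of_nat m = - complex_of_nat K"
  proof -
    have "of_int (int m) = complex_of_int (int K + n)" using m(3) by simp
    then show ?thesis by simp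
  qed
  also have "of_nat K * z ^ (K + m) / (z ^ K - \<epsilon>) ^ 2 + - of_nat K * z ^ m / (z ^ K - \<epsilon>) =
               of_nat K * \<epsilon> * z ^ m / (z ^ K - \<epsilon>) ^ 2"
  proof -
    have "k * ((p + \<epsilon>) * t) / p ^ 2 + - k * t / p = k * \<epsilon> * t / p ^ 2" if "p \<noteq> 0" for k t p :: complex
      using that by (simp add: field_simps power2_eq_square)
    from this[of "z ^ K - \<epsilon>" "of_nat K" "z ^ m"] show ?thesis
      using z(1) by (simp add: power_add)
  qed
  finally show ?thesis
    by (simp add: zn power2_eq_square mult_ac)
qed

lemma e2pi_minus_1: "e2pi (of_real u) - 1 = 2 * \<i> * e2pi (of_real (u / 2)) * of_real (sin (pi * u))"
  and e2pi_plus_1: "e2pi (of_real u) + 1 = 2 * e2pi (of_real (u / 2)) * of_real (cos (pi * u))"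
proof -
  have c: "e2pi (of_real v) = cis (2 * pi * v)" for v
    by (simp add: e2pi_def cis_conv_exp mult_ac)
  have "e2pi (of_real u) = e2pi (of_real (u/2)) * e2pi (of_real (u/2))"
    by (simp add: e2pi_add[symmetric])
  moreover have "e2pi (of_real (u/2)) = cis (pi * u)"
    unfolding c by simp
  moreover have "cis (pi * u) * cis (- (pi * u)) = 1"
    by (simp add: cis_mult)
  ultimately have *: "e2pi (of_real u) - 1 = cis (pi * u) * (cis (pi * u) - cis (- (pi * u)))"
    "e2pi (of_real u) + 1 = cis (pi * u) * (cis (pi * u) + cis (- (pi * u)))"
    "e2pi (of_real (u/2)) = cis (pi * u)"
    by (auto simp: algebra_simps)
  have "cis (pi * u) - cis (- (pi * u)) = 2 * \<i> * of_real (sin (pi * u))"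
    "cis (pi * u) + cis (- (pi * u)) = 2 * of_real (cos (pi * u))"
    by (auto simp: complex_eq_iff)
  then show "e2pi (of_real u) - 1 = 2 * \<i> * e2pi (of_real (u / 2)) * of_real (sin (pi * u))"
    "e2pi (of_real u) + 1 = 2 * e2pi (of_real (u / 2)) * of_real (cos (pi * u))"
    using * by simp_all
qed

text \<open>
  These translate the kernels of the trigonometric interpolation formula into rational functions
  of \<open>e2pi x\<close> and \<open>e2pi y\<close>.
\<close>

lemma csc_sq_and_cot_eq_e2pi:
  fixes x y :: real
  assumes "sin (pi * (x - y)) \<noteq> 0"
  shows "of_real (1 / sin (pi * (x - y)) ^ 2) =
           - 4 * e2pi (of_real x) * e2pi (of_real y) / (e2pi (of_real x) - e2pi (of_real y)) ^ 2"
    "of_real (cot (pi * (x - y))) =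
       \<i> * ((e2pi (of_real x) + e2pi (of_real y)) / (e2pi (of_real x) - e2pi (of_real y)))"
proof -
  define h where "h = e2pi (of_real ((x - y) / 2))"
  have h: "e2pi (of_real x) = h ^ 2 * e2pi (of_real y)"
    unfolding h_def power2_eq_square e2pi_add[symmetric] by (simp add: field_simps)
  have h2: "h ^ 2 = e2pi (of_real (x - y))"
    unfolding h_def power2_eq_square e2pi_add[symmetric] of_real_add[symmetric] by simp
  have hs: "h ^ 2 - 1 = 2 * \<i> * h * of_real (sin (pi * (x - y)))"
    "h ^ 2 + 1 = 2 * h * of_real (cos (pi * (x - y)))"
    using e2pi_minus_1[of "x - y"] e2pi_plus_1[of "x - y"]
    by (simp_all only: h2) (simp_all only: h_def)
  have nz: "h \<noteq> 0" "e2pi (of_real y) \<noteq> 0" by (auto simp: h_def)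
  have d: "e2pi (of_real x) - e2pi (of_real y) = 2 * \<i> * h * of_real (sin (pi * (x - y))) * e2pi (of_real y)"
    "e2pi (of_real x) + e2pi (of_real y) = 2 * h * of_real (cos (pi * (x - y))) * e2pi (of_real y)"
    unfolding hs[symmetric] by (simp_all add: h algebra_simps)
  show "of_real (1 / sin (pi * (x - y)) ^ 2) =
           - 4 * e2pi (of_real x) * e2pi (of_real y) / (e2pi (of_real x) - e2pi (of_real y)) ^ 2"
    unfolding d using assms nz by (simp add: h power_mult_distrib) (simp add: power2_eq_square)
  show "of_real (cot (pi * (x - y))) =
       \<i> * ((e2pi (of_real x) + e2pi (of_real y)) / (e2pi (of_real x) - e2pi (of_real y)))"
    unfolding d using assms nz by (simp add: cot_def)
qed

text \<open>
  The only multiple of \<open>N + 1\<close> among the frequencies \<open>- N, \<dots>, N\<close> is 0.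
\<close>

lemma trig_poly_quadrature:
  assumes q: "\<And>x. q x = (\<Sum>n = - int N..int N. c n * e2pi (of_int n * of_real x))"
  shows "(\<Sum>j<N + 1. q ((real j + \<theta>) / real (N + 1))) = of_nat (N + 1) * c 0"
proof -
  have "(\<Sum>j<N + 1. q ((real j + \<theta>) / real (N + 1))) =
      (\<Sum>n = - int N..int N. c n * (\<Sum>j<N + 1. e2pi (of_int n * of_real ((real j + \<theta>) / real (N + 1)))))"
    unfolding q by (subst sum.swap) (simp only: sum_distrib_left)
  also have "\<dots> = (\<Sum>n = - int N..int N. if n = 0 then of_nat (N + 1) * c 0 else 0)"
  proof (rule sum.cong)
    fix n assume n: "n \<in> {- int N..int N}"
    have "int (N + 1) dvd n \<longleftrightarrow> n = 0"
    proof
      assume dvd: "int (N + 1) dvd n"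
      show "n = 0"
      proof (rule ccontr)
        assume "n \<noteq> 0"
        then have "\<bar>int (N + 1)\<bar> \<le> \<bar>n\<bar>" using dvd by (rule dvd_imp_le_int)
        moreover have "\<bar>n\<bar> \<le> int N" using n by (auto simp: abs_le_iff)
        ultimately show False by linarith
      qed
    qed simp
    then show "c n * (\<Sum>j<N + 1. e2pi (of_int n * of_real ((real j + \<theta>) / real (N + 1)))) =
        (if n = 0 then of_nat (N + 1) * c 0 else 0)"
      by (subst sum_e2pi_nodes) (auto simp: e2pi_def)
  qed simp
  also have "\<dots> = of_nat (N + 1) * c 0"
    by simp
  finally show ?thesis .
qed

text \<open>
  By linearity it suffices to treat a single frequency \<open>n\<close>; then both sides are rational
  functions of \<open>e2pi x\<close>, with poles at the nodes, and the identity is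
  \<open>hermite_node_sum_powi\<close>.
\<close>

lemma trig_poly_hermite:
  assumes q: "\<And>x. q x = (\<Sum>n = - int N..int N. c n * e2pi (of_int n * of_real x))"
    and q': "\<And>x. q' x = (\<Sum>n = - int N..int N. c n * (2 * of_real pi * \<i> * of_int n) * e2pi (of_int n * of_real x))"
    and x: "sin (pi * (real (N + 1) * x - \<theta>)) \<noteq> 0"
    and K: "K = N + 1" and X: "\<And>j. X j = (real j + \<theta>) / real K"
  shows "(\<Sum>j<K. q (X j) * of_real (1 / sin (pi * (x - X j)) ^ 2) + q' (X j) / of_real pi * of_real (cot (pi * (x - X j)))) =
           of_nat K ^ 2 * q x * of_real (1 / sin (pi * (real K * x - \<theta>)) ^ 2)"
proof -
  define z where "z = e2pi (of_real x)"
  define w where "w j = e2pi (of_real (X j))" for j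
  define \<epsilon> where "\<epsilon> = e2pi (of_real \<theta>)"
  have K0: "K > 0" by (simp add: K)
  have wK: "w j ^ K = \<epsilon>" for j
  proof -
    have "w j ^ K = e2pi (of_real (real K * X j))"
      unfolding w_def e2pi_of_nat_mult[symmetric] by simp
    also have "real K * X j = real j + \<theta>" using K0 by (simp add: X)
    also have "e2pi (of_real (real j + \<theta>)) = \<epsilon>"
      using e2pi_of_int[of "int j"] by (simp add: e2pi_add \<epsilon>_def)
    finally show ?thesis .
  qed
  have pow: "(\<Sum>j<K. w j ^ m) = (if m = K then of_nat K * \<epsilon> else 0)" if m: "1 \<le> m" "m < 2 * K" for m
  proof (cases "m = K")
    case True
    then show ?thesis by (simp add: wK)
  next
    case False
    have "\<not> K dvd m"
    proof
      assume "K dvd m"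
      then obtain i where "m = K * i" by blast
      then show False using m False by (cases i rule: nat.exhaust; cases "i - 1") auto
    qed
    then have "\<not> int K dvd int m" by simp
    then show ?thesis
      using sum_e2pi_nodes[OF K0, of "int m" \<theta>] False
      by (simp add: w_def e2pi_of_nat_mult[symmetric] X)
  qed
  have zK: "z ^ K = e2pi (of_real (real K * x))"
    unfolding z_def e2pi_of_nat_mult[symmetric] by simp
  have inv: "of_real (1 / sin (pi * (real K * x - \<theta>)) ^ 2) = - 4 * z ^ K * \<epsilon> / (z ^ K - \<epsilon>) ^ 2"
    unfolding zK \<epsilon>_def by (rule csc_sq_and_cot_eq_e2pi(1)) (use x in \<open>simp only: K not_False_eq_True\<close>)
  have zK': "z ^ K \<noteq> \<epsilon>"
  proof
    assume "z ^ K = \<epsilon>"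
    then have "of_real (1 / sin (pi * (real K * x - \<theta>)) ^ 2) = (0::complex)"
      unfolding inv by simp
    then show False using x unfolding K of_real_eq_0_iff by simp
  qed
  have sin: "sin (pi * (x - X j)) \<noteq> 0" for j
  proof
    assume "sin (pi * (x - X j)) = 0"
    then have "z = w j"
      using e2pi_minus_1[of "x - X j"] e2pi_add[of "of_real (x - X j)" "of_real (X j)"]
      by (simp add: z_def w_def)
    then show False using wK[of j] zK' by simp
  qed
  have mono: "(\<Sum>j<K. e2pi (of_int n * of_real (X j)) * of_real (1 / sin (pi * (x - X j)) ^ 2) +
        (2 * of_real pi * \<i> * of_int n) * e2pi (of_int n * of_real (X j)) / of_real pi * of_real (cot (pi * (x - X j)))) =
      of_nat K ^ 2 * e2pi (of_int n * of_real x) * of_real (1 / sin (pi * (real K * x - \<theta>)) ^ 2)" (is "?l = ?r")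
    if n: "n \<in> {- int N..int N}" for n
  proof -
    have "?l = (\<Sum>j<K. w j powi n * (- 4 * z * w j / (z - w j) ^ 2 - 2 * of_int n * ((z + w j) / (z - w j))))"
      unfolding csc_sq_and_cot_eq_e2pi[OF sin] e2pi_of_int_mult z_def[symmetric] w_def[symmetric]
    proof (intro sum.cong refl)
      have "p * A + 2 * of_real pi * \<i> * of_int n * p / of_real pi * (\<i> * B) = p * (A - 2 * of_int n * B)"
        for p A B :: complex
        by (simp add: algebra_simps)
      then show "w j powi n * (- 4 * z * w j / (z - w j) ^ 2) +
          2 * of_real pi * \<i> * of_int n * w j powi n / of_real pi * (\<i> * ((z + w j) / (z - w j))) =
          w j powi n * (- 4 * z * w j / (z - w j) ^ 2 - 2 * of_int n * ((z + w j) / (z - w j)))" for j .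
    qed
    also have "\<dots> = - 4 * of_nat K ^ 2 * \<epsilon> * z ^ K * z powi n / (z ^ K - \<epsilon>) ^ 2"
      by (rule hermite_node_sum_powi) (use wK pow zK' n K in \<open>auto simp: z_def \<epsilon>_def\<close>)
    also have "\<dots> = ?r"
      unfolding inv e2pi_of_int_mult z_def[symmetric] by (simp add: mult_ac)
    finally show ?thesis .
  qed
  have "(\<Sum>j<K. q (X j) * of_real (1 / sin (pi * (x - X j)) ^ 2) + q' (X j) / of_real pi * of_real (cot (pi * (x - X j)))) =
      (\<Sum>j<K. \<Sum>n = - int N..int N. c n * (e2pi (of_int n * of_real (X j)) * of_real (1 / sin (pi * (x - X j)) ^ 2) +
        (2 * of_real pi * \<i> * of_int n) * e2pi (of_int n * of_real (X j)) / of_real pi * of_real (cot (pi * (x - X j)))))"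
    unfolding q q' sum_distrib_right sum_divide_distrib sum.distrib[symmetric]
    by (intro sum.cong) (auto simp: distrib_left mult_ac)
  also have "\<dots> = (\<Sum>n = - int N..int N. c n * (of_nat K ^ 2 * e2pi (of_int n * of_real x) * of_real (1 / sin (pi * (real K * x - \<theta>)) ^ 2)))"
    by (subst sum.swap) (simp only: sum_distrib_left[symmetric] mono cong: sum.cong)
  also have "\<dots> = of_nat K ^ 2 * q x * of_real (1 / sin (pi * (real K * x - \<theta>)) ^ 2)"
    unfolding q sum_distrib_right sum_distrib_left by (intro sum.cong) (auto simp: mult_ac)
  finally show ?thesis .
qed

section \<open>Partial fractions of the cotangent and the squared cosecant\<close>

text \<open>
  The logarithmic derivative of Euler's reflection formula for the Gamma function. Together with
  the series of the polygamma functions it yields the partial fraction expansions below.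
\<close>

lemma Digamma_reflection:
  fixes z :: complex
  assumes "z \<notin> \<int>"
  shows "Digamma (1 - z) - Digamma z = of_real pi * cot (of_real pi * z)"
proof -
  have z1: "1 - z \<notin> \<int>"
    using assms by (metis Ints_1 Ints_diff add_diff_cancel_left' diff_add_cancel)
  have nz: "z \<notin> \<int>\<^sub>\<le>\<^sub>0" "1 - z \<notin> \<int>\<^sub>\<le>\<^sub>0"
    using assms z1 by (metis nonpos_Ints_cases Ints_of_int)+
  have sin: "sin (of_real pi * z) \<noteq> 0"
    using assms sin_eq_0[of "of_real pi * z"] by (auto simp: mult.commute)
  have "((\<lambda>z. Gamma z * Gamma (1 - z)) has_field_derivative
          Gamma z * Gamma (1 - z) * (Digamma z - Digamma (1 - z))) (at z)"
    using nz by (auto intro!: derivative_eq_intros simp: algebra_simps)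
  moreover have "((\<lambda>z. Gamma z * Gamma (1 - z)) has_field_derivative
          - (of_real pi * (of_real pi * cos (of_real pi * z)) / sin (of_real pi * z) ^ 2)) (at z)"
    unfolding Gamma_reflection_complex
    using sin by (auto intro!: derivative_eq_intros simp: power2_eq_square)
  ultimately have "Gamma z * Gamma (1 - z) * (Digamma z - Digamma (1 - z)) =
      - (of_real pi * (of_real pi * cos (of_real pi * z)) / sin (of_real pi * z) ^ 2)"
    by (rule DERIV_unique)
  then have "of_real pi / sin (of_real pi * z) * (Digamma z - Digamma (1 - z)) =
      of_real pi / sin (of_real pi * z) * (- (of_real pi * cot (of_real pi * z)))"
    unfolding Gamma_reflection_complex by (simp add: cot_def power2_eq_square)
  then have "Digamma z - Digamma (1 - z) = - (of_real pi * cot (of_real pi * z))"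
    using sin by (metis divide_eq_0_iff mult_left_cancel of_real_eq_0_iff pi_neq_zero)
  then show ?thesis
    by (metis minus_diff_eq minus_minus)
qed

lemma Trigamma_reflection:
  fixes z :: complex
  assumes "z \<notin> \<int>"
  shows "Polygamma 1 z + Polygamma 1 (1 - z) = (of_real pi / sin (of_real pi * z)) ^ 2"
proof -
  have z1: "1 - z \<notin> \<int>"
    using assms by (metis Ints_1 Ints_diff add_diff_cancel_left' diff_add_cancel)
  have nz: "z \<notin> \<int>\<^sub>\<le>\<^sub>0" "1 - z \<notin> \<int>\<^sub>\<le>\<^sub>0"
    using assms z1 by (metis nonpos_Ints_cases Ints_of_int)+
  have sin: "sin (of_real pi * z) \<noteq> 0"
    using assms sin_eq_0[of "of_real pi * z"] by (auto simp: mult.commute)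
  have "((\<lambda>z. Digamma (1 - z) - Digamma z) has_field_derivative
          - Polygamma 1 (1 - z) - Polygamma 1 z) (at z)"
    using nz by (auto intro!: derivative_eq_intros)
  moreover have "((\<lambda>z. Digamma (1 - z) - Digamma z) has_field_derivative
          of_real pi * (- inverse (sin (of_real pi * z) ^ 2) * of_real pi)) (at z)"
  proof (rule has_field_derivative_transform_within_open[where S = "- \<int>"])
    have "((\<lambda>z. cot (of_real pi * z)) has_field_derivative
            - inverse (sin (of_real pi * z) ^ 2) * of_real pi) (at z)"
      by (rule DERIV_chain2[where f = cot and g = "\<lambda>z. of_real pi * z", OF DERIV_cot[OF sin]]) (auto intro!: derivative_eq_intros)
    then show "((\<lambda>z. of_real pi * cot (of_real pi * z)) has_field_derivative
          of_real pi * (- inverse (sin (of_real pi * z) ^ 2) * of_real pi)) (at z)"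
      by (rule DERIV_cmult)
    show "open (- \<int> :: complex set)" by (simp add: open_Compl)
  qed (use assms Digamma_reflection in auto)
  ultimately have "- Polygamma 1 (1 - z) - Polygamma 1 z =
      of_real pi * (- inverse (sin (of_real pi * z) ^ 2) * of_real pi)"
    by (rule DERIV_unique)
  then have "Polygamma 1 z + Polygamma 1 (1 - z) = of_real pi * (inverse (sin (of_real pi * z) ^ 2) * of_real pi)"
    by (metis (no_types, lifting) minus_add_distrib minus_mult_left minus_mult_right minus_minus uminus_add_conv_diff diff_conv_add_uminus add.commute)
  then show ?thesis
    by (simp add: power_divide power2_eq_square divide_inverse)
qed

text \<open>
  The series of \<open>Polygamma 1\<close> at \<open>x\<close> and at \<open>1 - x\<close> are the two halves of the sum over the integers.
\<close>

lemma has_sum_inverse_squares_int: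
  fixes x :: real
  assumes "x \<notin> \<int>"
  shows "((\<lambda>n::int. 1 / (x + of_int n) ^ 2) has_sum (pi / sin (pi * x)) ^ 2) UNIV"
proof -
  have x1: "1 - x \<notin> \<int>"
    using assms by (metis Ints_1 Ints_diff add_diff_cancel_left' diff_add_cancel)
  have nz: "x \<noteq> 0" "1 - x \<noteq> 0" using assms by auto
  have P: "((\<lambda>k. 1 / (y + of_nat k) ^ 2) has_sum Polygamma 1 y) UNIV" if "y \<noteq> 0" for y :: real
  proof (rule sums_nonneg_imp_has_sum)
    have "summable (\<lambda>k. inverse ((y + of_nat k) ^ 2))"
      using that by (intro Polygamma_converges') auto
    then show "(\<lambda>k. 1 / (y + of_nat k) ^ 2) sums Polygamma 1 y"
      by (auto simp: Polygamma_def divide_inverse numeral_2_eq_2 dest: summable_sums)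
  qed auto
  have "sin (complex_of_real pi * of_real x) = of_real (sin (pi * x))"
    by (metis of_real_mult sin_of_real)
  then have "of_real (Polygamma 1 x + Polygamma 1 (1 - x)) = complex_of_real ((pi / sin (pi * x)) ^ 2)"
    using Trigamma_reflection[of "of_real x"] assms nz
      Polygamma_of_real[of x 1, where 'a = complex] Polygamma_of_real[of "1 - x" 1, where 'a = complex]
    by simp
  then have val: "Polygamma 1 x + Polygamma 1 (1 - x) = (pi / sin (pi * x)) ^ 2"
    by (simp only: of_real_eq_iff)
  have "(x + of_int (- int k - 1)) ^ 2 = (1 - x + of_nat k) ^ 2" for k
    by (simp add: power2_eq_square algebra_simps)
  then show ?thesis
    using has_sum_int_split[of "\<lambda>n. 1 / (x + of_int n) ^ 2", OF _ _] P[OF nz(1)] P[OF nz(2)]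
    by (simp add: val[symmetric])
qed

text \<open>
  The terms \<open>1 / (x + n)\<close> alone are not summable over the integers; a difference of two of them is of
  order \<open>1 / n\<^sup>2\<close>, and this is the form in which the cotangent is needed.
\<close>

lemma has_sum_cot_differences_int:
  fixes x y :: real
  assumes "x \<notin> \<int>" "y \<notin> \<int>"
  shows "((\<lambda>n::int. 1 / (x + of_int n) - 1 / (y + of_int n)) has_sum
            (pi * cot (pi * x) - pi * cot (pi * y))) UNIV"
proof -
  have D: "((\<lambda>k. 1 / (u + of_nat k) - 1 / (v + of_nat k)) has_sum (Digamma v - Digamma u)) UNIV"
    if "u \<notin> \<int>" "v \<notin> \<int>" for u v :: real
  proof (rule norm_summable_imp_has_sum)
    have nz: "u \<noteq> 0" "v \<noteq> 0" using that by auto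
    have nz': "u + of_nat k \<noteq> 0" "v + of_nat k \<noteq> 0" for k
      using that by (metis add_eq_0_iff2 Ints_minus Ints_of_nat)+
    have "(\<lambda>k. (inverse (of_nat (Suc k)) - inverse (v + of_nat k)) - (inverse (of_nat (Suc k)) - inverse (u + of_nat k)))
            sums ((Digamma v + euler_mascheroni) - (Digamma u + euler_mascheroni))"
      by (intro sums_diff) (use nz summable_Digamma in \<open>auto simp: Digamma_def intro!: summable_sums\<close>)
    then show "(\<lambda>k. 1 / (u + of_nat k) - 1 / (v + of_nat k)) sums (Digamma v - Digamma u)"
      by (simp add: divide_inverse)
    have "summable (\<lambda>k. \<bar>v - u\<bar> * (inverse ((u + of_nat k) ^ 2) + inverse ((v + of_nat k) ^ 2)))"
      using nz by (intro summable_mult summable_add Polygamma_converges') auto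
    then show "summable (\<lambda>k. norm (1 / (u + of_nat k) - 1 / (v + of_nat k)))"
    proof (rule summable_comparison_test'[where N = 0])
      fix k :: nat
      define a b where "a = \<bar>inverse (u + of_nat k)\<bar>" and "b = \<bar>inverse (v + of_nat k)\<bar>"
      have "1 / (u + of_nat k) - 1 / (v + of_nat k) = (v - u) * (inverse (u + of_nat k) * inverse (v + of_nat k))"
        using nz'[of k] by (simp add: field_simps)
      then have "\<bar>1 / (u + of_nat k) - 1 / (v + of_nat k)\<bar> = \<bar>v - u\<bar> * (a * b)"
        by (simp add: abs_mult a_def b_def)
      also have "\<dots> \<le> \<bar>v - u\<bar> * (a ^ 2 + b ^ 2)"
      proof (rule mult_left_mono)
        show "a * b \<le> a ^ 2 + b ^ 2"
          using sum_squares_bound[of a b] sum_power2_ge_zero[of a b] by linarith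
      qed simp
      finally have "\<bar>1 / (u + of_nat k) - 1 / (v + of_nat k)\<bar> \<le> \<bar>v - u\<bar> * (a ^ 2 + b ^ 2)" .
      then show "norm (norm (1 / (u + of_nat k) - 1 / (v + of_nat k))) \<le>
          \<bar>v - u\<bar> * (inverse ((u + of_nat k) ^ 2) + inverse ((v + of_nat k) ^ 2))"
        by (simp add: a_def b_def power_inverse)
    qed
  qed
  have refl: "Digamma (1 - u) - Digamma u = pi * cot (pi * u)" if "u \<notin> \<int>" for u :: real
  proof -
    have nz: "u \<noteq> 0" "1 - u \<noteq> 0" using that by auto
    have "of_real (Digamma (1 - u) - Digamma u) = complex_of_real (pi * cot (pi * u))"
      using Digamma_reflection[of "of_real u"] that nz
        Polygamma_of_real[of u 0, where 'a = complex] Polygamma_of_real[of "1 - u" 0, where 'a = complex]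
      by (simp add: cot_of_real)
    then show ?thesis by (simp only: of_real_eq_iff)
  qed
  have 1: "1 - x \<notin> \<int>" "1 - y \<notin> \<int>"
    using assms by (metis Ints_1 Ints_diff add_diff_cancel_left' diff_add_cancel)+
  have "1 / (x + of_int (- int k - 1)) - 1 / (y + of_int (- int k - 1)) =
          1 / (1 - y + of_nat k) - 1 / (1 - x + of_nat k)" for k
  proof -
    have "x + of_int (- int k - 1) = - (1 - x + of_nat k)" "y + of_int (- int k - 1) = - (1 - y + of_nat k)"
      by auto
    then show ?thesis by (simp only: divide_minus_right)
  qed
  moreover have "pi * cot (pi * x) - pi * cot (pi * y) =
      (Digamma y - Digamma x) + (Digamma (1 - x) - Digamma (1 - y))"
    using refl[OF assms(1)] refl[OF assms(2)] by simp
  ultimately show ?thesis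
    using has_sum_int_split[of "\<lambda>n. 1 / (x + of_int n) - 1 / (y + of_int n)", OF _ _]
      D[OF assms] D[OF 1(2,1)] by simp
qed

section \<open>Periodizing the interpolation series\<close>

text \<open>
  After the injective change of indices \<open>(n, m) \<mapsto> (K * n - m, m)\<close> the double series becomes part of a
  product of two summable families.
\<close>

lemma summable_on_shifted_inverse_squares:
  fixes u :: real and \<gamma> :: "int \<Rightarrow> real"
  assumes u: "u \<notin> \<int>" and K: "K > 0"
    and \<gamma>: "(\<lambda>m. \<bar>\<gamma> m\<bar>) summable_on UNIV"
  shows "(\<lambda>(n::int, m::int). \<bar>\<gamma> m\<bar> / (u + of_int (int K * n - m)) ^ 2) summable_on UNIV"
proof -
  define \<beta> where "\<beta> i = 1 / (u + of_int i) ^ 2" for i :: int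
  define f where "f = (\<lambda>(i, m). \<beta> i * \<bar>\<gamma> m\<bar>)"
  define h where "h = (\<lambda>(n, m). (int K * n - m, m))"
  obtain S where S: "((\<lambda>m. \<bar>\<gamma> m\<bar>) has_sum S) UNIV"
    using \<gamma> by (auto simp: summable_on_def)
  have "f summable_on (SIGMA i:UNIV. UNIV)"
  proof (rule summable_on_SigmaI)
    show "((\<lambda>m. f (i, m)) has_sum (\<beta> i * S)) UNIV" for i
      unfolding f_def using has_sum_cmult_right[OF S] by simp
    show "(\<lambda>i. \<beta> i * S) summable_on UNIV"
      using has_sum_inverse_squares_int[OF u]
      by (intro summable_on_cmult_left) (auto simp: \<beta>_def summable_on_def)
  qed (auto simp: f_def \<beta>_def)
  then have "f summable_on range h"
    by (rule summable_on_subset_banach) auto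
  moreover have "inj h"
    using K by (auto simp: h_def inj_on_def)
  ultimately have "(f \<circ> h) summable_on UNIV"
    using summable_on_reindex by blast
  moreover have "f \<circ> h = (\<lambda>(n, m). \<bar>\<gamma> m\<bar> / (u + of_int (int K * n - m)) ^ 2)"
    by (auto simp: f_def h_def \<beta>_def fun_eq_iff)
  ultimately show ?thesis by simp
qed

text \<open>
  The heart of the identification of \<open>l_poly\<close> and \<open>m_poly\<close>. The reflection \<open>m \<mapsto> - m - s\<close> sends the
  interpolation point \<open>c + m\<close> to its negative and reverses the sign of \<open>\<delta>\<close>, so \<open>\<delta> m / (z - a)\<close> may be
  replaced by \<open>\<delta> m * (1 / (z - a) - 1 / (z + a)) / 2\<close> with \<open>a = c + m\<close>. The latter is
  \<open>\<delta> m * a / ((z - a) * (z + a))\<close>, which makes the double series over periods and interpolation points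
  absolutely summable. The order of summation can then be exchanged, the sums over the periods
  are known in closed form, and they depend only on \<open>m\<close> modulo \<open>K\<close>.
\<close>

lemma has_sum_periodized_interpolation_series:
  fixes \<gamma> \<delta> :: "int \<Rightarrow> real" and x c :: real and s :: int and K :: nat
  assumes K: "K > 0" and x: "real K * x - c \<notin> \<int>" and c: "2 * c = of_int s"
    and \<gamma>: "(\<lambda>m. \<bar>\<gamma> m\<bar>) summable_on UNIV"
    and \<delta>: "(\<lambda>m. \<bar>\<delta> m\<bar>) summable_on UNIV" "(\<lambda>m. \<bar>\<delta> m * (c + of_int m)\<bar>) summable_on UNIV"
    and odd: "\<And>m. \<delta> (- m - s) = - \<delta> m"
    and z: "\<And>n. z n = real K * (x + of_int n)" and X: "\<And>j. X j = (real j + c) / real K"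
  shows "((\<lambda>n::int. (\<Sum>\<^sub>\<infinity>m. \<gamma> m / (z n - (c + of_int m)) ^ 2) + (\<Sum>\<^sub>\<infinity>m. \<delta> m / (z n - (c + of_int m)))) has_sum
            (\<Sum>j<K. (\<Sum>\<^sub>\<infinity>p. \<gamma> (int j + int K * p)) * (pi / (real K * sin (pi * (x - X j)))) ^ 2 +
                    (\<Sum>\<^sub>\<infinity>p. \<delta> (int j + int K * p)) * (pi / real K * cot (pi * (x - X j))))) UNIV"
proof -
  define a where "a m = c + real_of_int m" for m
  define \<sigma> where "\<sigma> m = - m - s" for m
  have a\<sigma>: "a (\<sigma> m) = - a m" for m
    using c by (simp add: a_def \<sigma>_def)
  have bij\<sigma>: "bij \<sigma>"
    by (rule bijI'[OF _ exI[of _ "- y - s" for y]]) (auto simp: \<sigma>_def)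
  have zn: "z n - a m = (real K * x - c) + of_int (int K * n - m)" for n m
    by (simp add: z a_def algebra_simps)
  have nonint: "u + of_int i \<notin> \<int>" if "u \<notin> \<int>" for u :: real and i
    using that by (metis Ints_diff Ints_of_int add_diff_cancel_right')
  have zn0: "z n - a m \<noteq> 0" "z n + a m \<noteq> 0" for n m
    using nonint[OF x] a\<sigma>[of m] zn[of n m] zn[of n "\<sigma> m"]
    by (metis Ints_0, metis Ints_0 diff_minus_eq_add)
  define t where "t n m = \<gamma> m / (z n - a m) ^ 2 + \<delta> m * ((1 / (z n - a m) - 1 / (z n + a m)) / 2)" for n m
  have sq: "(\<lambda>(n, m). \<bar>g m\<bar> / (z n - a m) ^ 2) summable_on UNIV" if "(\<lambda>m. \<bar>g m\<bar>) summable_on UNIV" for g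
    using summable_on_shifted_inverse_squares[OF x K that] by (simp add: zn)
  have sq': "(\<lambda>(n, m). \<bar>\<delta> m * a m\<bar> / (z n + a m) ^ 2) summable_on UNIV"
  proof -
    let ?f = "\<lambda>(n, m). \<bar>\<delta> m * a m\<bar> / (z n - a m) ^ 2"
    have "bij (map_prod id \<sigma>)"
      using bij\<sigma> by (metis bij_betw_id bij_betw_map_prod UNIV_Times_UNIV)
    then have "(\<lambda>p. ?f (map_prod id \<sigma> p)) summable_on UNIV"
      using sq[of "\<lambda>m. \<delta> m * a m"] \<delta>(2) summable_on_reindex_bij_betw[of "map_prod id \<sigma>" UNIV UNIV ?f]
      by (simp add: a_def)
    moreover have "\<bar>\<delta> (\<sigma> m) * a (\<sigma> m)\<bar> = \<bar>\<delta> m * a m\<bar>" for m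
      using odd[of m] by (simp add: a\<sigma>) (simp add: \<sigma>_def)
    ultimately show ?thesis
      by (simp add: case_prod_unfold a\<sigma>)
  qed
  have "(\<lambda>p. norm (case p of (n, m) \<Rightarrow> t n m)) summable_on UNIV"
  proof (rule summable_on_comparison_test)
    show "(\<lambda>p. (case p of (n, m) \<Rightarrow> \<bar>\<gamma> m\<bar> / (z n - a m) ^ 2) +
        ((case p of (n, m) \<Rightarrow> \<bar>\<delta> m * a m\<bar> / (z n - a m) ^ 2) +
         (case p of (n, m) \<Rightarrow> \<bar>\<delta> m * a m\<bar> / (z n + a m) ^ 2))) summable_on UNIV"
      using \<delta>(2) by (intro summable_on_add sq sq' \<gamma>) (simp add: a_def)
    fix p :: "int \<times> int"
    obtain n m where p: "p = (n, m)" by fastforce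
    define u v where "u = 1 / \<bar>z n - a m\<bar>" and "v = 1 / \<bar>z n + a m\<bar>"
    have "(1 / (z n - a m) - 1 / (z n + a m)) / 2 = a m * (1 / (z n - a m) * (1 / (z n + a m)))"
    proof -
      have "(1 / p - 1 / q) / 2 = ((q - p) / 2) * (1 / p * (1 / q))" if "p \<noteq> 0" "q \<noteq> 0" for p q :: real
        using that by (simp add: field_simps)
      from this[OF zn0[of n m]] show ?thesis by simp
    qed
    then have "\<bar>\<delta> m * ((1 / (z n - a m) - 1 / (z n + a m)) / 2)\<bar> = \<bar>\<delta> m * a m\<bar> * (u * v)"
      by (simp add: abs_mult u_def v_def)
    also have "\<dots> \<le> \<bar>\<delta> m * a m\<bar> * (u ^ 2 + v ^ 2)"
    proof (rule mult_left_mono)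
      show "u * v \<le> u ^ 2 + v ^ 2"
        using sum_squares_bound[of u v] sum_power2_ge_zero[of u v] by linarith
    qed simp
    also have "\<dots> = \<bar>\<delta> m * a m\<bar> / (z n - a m) ^ 2 + \<bar>\<delta> m * a m\<bar> / (z n + a m) ^ 2"
      by (simp add: u_def v_def power_divide distrib_left)
    finally have "\<bar>\<delta> m * ((1 / (z n - a m) - 1 / (z n + a m)) / 2)\<bar> \<le>
        \<bar>\<delta> m * a m\<bar> / (z n - a m) ^ 2 + \<bar>\<delta> m * a m\<bar> / (z n + a m) ^ 2" .
    moreover have "\<bar>\<gamma> m / (z n - a m) ^ 2\<bar> = \<bar>\<gamma> m\<bar> / (z n - a m) ^ 2" by simp
    ultimately show "norm (case p of (n, m) \<Rightarrow> t n m) \<le>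
        (case p of (n, m) \<Rightarrow> \<bar>\<gamma> m\<bar> / (z n - a m) ^ 2) +
        ((case p of (n, m) \<Rightarrow> \<bar>\<delta> m * a m\<bar> / (z n - a m) ^ 2) +
         (case p of (n, m) \<Rightarrow> \<bar>\<delta> m * a m\<bar> / (z n + a m) ^ 2))"
      unfolding p t_def prod.case real_norm_def by linarith
  qed auto
  then have "(\<lambda>(n, m). t n m) summable_on UNIV"
    by (rule abs_summable_summable)
  then obtain S where S: "((\<lambda>(n, m). t n m) has_sum S) (UNIV \<times> UNIV)"
    by (auto simp: summable_on_def)
  \<comment> \<open>For a fixed period the symmetrized series has the sum of the original one.\<close>
  have row: "(t n has_sum ((\<Sum>\<^sub>\<infinity>m. \<gamma> m / (z n - a m) ^ 2) + (\<Sum>\<^sub>\<infinity>m. \<delta> m / (z n - a m)))) UNIV" for n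
  proof -
    define d where "d = (\<lambda>m. \<delta> m / (z n - a m))"
    obtain q where q: "q > 0" "\<And>m. q \<le> \<bar>z n - a m\<bar>"
    proof
      let ?u = "real K * x - c"
      show "min (frac ?u) (1 - frac ?u) > 0"
        using x frac_lt_1[of ?u] by (simp add: frac_gt_0_iff)
      show "min (frac ?u) (1 - frac ?u) \<le> \<bar>z n - a m\<bar>" for m
      proof -
        define i where "i = \<lfloor>?u\<rfloor> + (int K * n - m)"
        have "z n - a m = frac ?u + of_int i"
          by (simp add: zn frac_def i_def)
        moreover have "i \<ge> 0 \<or> i \<le> - 1" by linarith
        then have "real_of_int i \<ge> 0 \<or> real_of_int i \<le> - 1" by linarith
        ultimately show ?thesis
          using frac_ge_0[of ?u] frac_lt_1[of ?u] by linarith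
      qed
    qed
    have bound: "(\<lambda>m. g m / (z n - a m) ^ e) summable_on UNIV" if "(\<lambda>m. \<bar>g m\<bar>) summable_on UNIV" for g e
    proof (rule abs_summable_summable, rule summable_on_comparison_test)
      show "(\<lambda>m. \<bar>g m\<bar> * (1 / q ^ e)) summable_on UNIV"
        by (intro summable_on_cmult_left that)
      show "norm (g m / (z n - a m) ^ e) \<le> \<bar>g m\<bar> * (1 / q ^ e)" for m
      proof -
        have "q ^ e \<le> \<bar>z n - a m\<bar> ^ e" using q by (intro power_mono) auto
        then have "1 / \<bar>z n - a m\<bar> ^ e \<le> 1 / q ^ e"
          using q(1) by (intro frac_le) auto
        then have "\<bar>g m\<bar> * (1 / \<bar>z n - a m\<bar> ^ e) \<le> \<bar>g m\<bar> * (1 / q ^ e)"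
          by (intro mult_left_mono) auto
        then show ?thesis by (simp add: power_abs)
      qed
    qed auto
    have "d summable_on UNIV" using bound[OF \<delta>(1), of 1] by (simp add: d_def)
    then have d: "(d has_sum infsum d UNIV) UNIV" by simp
    then have "((\<lambda>m. d (\<sigma> m)) has_sum infsum d UNIV) UNIV"
      using has_sum_reindex_bij_betw[OF bij\<sigma>] by blast
    then have "((\<lambda>m. (d m + d (\<sigma> m)) * (1 / 2)) has_sum ((infsum d UNIV + infsum d UNIV) * (1 / 2))) UNIV"
      using d by (intro has_sum_cmult_left has_sum_add)
    moreover have "d (\<sigma> m) = - (\<delta> m / (z n + a m))" for m
      using odd[of m] a\<sigma>[of m] by (simp add: d_def \<sigma>_def)
    ultimately have "((\<lambda>m. \<delta> m * ((1 / (z n - a m) - 1 / (z n + a m)) / 2)) has_sum infsum d UNIV) UNIV"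
      by (simp add: d_def right_diff_distrib)
    moreover have "((\<lambda>m. \<gamma> m / (z n - a m) ^ 2) has_sum (\<Sum>\<^sub>\<infinity>m. \<gamma> m / (z n - a m) ^ 2)) UNIV"
      using bound[OF \<gamma>] by simp
    ultimately show ?thesis
      unfolding t_def d_def by (intro has_sum_add)
  qed
  have 1: "((\<lambda>n. (\<Sum>\<^sub>\<infinity>m. \<gamma> m / (z n - a m) ^ 2) + (\<Sum>\<^sub>\<infinity>m. \<delta> m / (z n - a m))) has_sum S) UNIV"
    by (rule has_sum_SigmaD[OF S]) (use row in auto)
  \<comment> \<open>Now the sum over the periods for a fixed interpolation point.\<close>
  define y where "y m = a m / real K" for m
  have xy: "x - y m \<notin> \<int>" for m
  proof
    assume "x - y m \<in> \<int>"
    then have "real K * (x - y m) + of_int m \<in> \<int>" by (intro Ints_add Ints_mult) auto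
    also have "real K * (x - y m) + of_int m = real K * x - c"
      using K by (simp add: y_def a_def field_simps)
    finally show False using x by simp
  qed
  have y\<sigma>: "y (\<sigma> m) = - y m" for m by (simp add: y_def a\<sigma>)
  define V where "V m = \<gamma> m * (pi / (real K * sin (pi * (x - y m)))) ^ 2" for m
  define U where "U m = \<delta> m * (pi / real K * cot (pi * (x - y m)))" for m
  have "((\<lambda>n. t n m) has_sum (V m + (U m + U (\<sigma> m)) * (1 / 2))) UNIV" for m
  proof -
    have e: "z n - a m = real K * (x - y m + of_int n)" "z n + a m = real K * (x - y (\<sigma> m) + of_int n)" for n
      using K by (simp_all add: z y_def a\<sigma> field_simps)
    have "((\<lambda>n. \<gamma> m / real K ^ 2 * (1 / (x - y m + of_int n) ^ 2)) has_sum
             \<gamma> m / real K ^ 2 * (pi / sin (pi * (x - y m))) ^ 2) UNIV"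
      by (intro has_sum_cmult_right has_sum_inverse_squares_int xy)
    moreover have "((\<lambda>n. \<delta> m / (2 * real K) * (1 / (x - y m + of_int n) - 1 / (x - y (\<sigma> m) + of_int n))) has_sum
             \<delta> m / (2 * real K) * (pi * cot (pi * (x - y m)) - pi * cot (pi * (x - y (\<sigma> m))))) UNIV"
      by (intro has_sum_cmult_right has_sum_cot_differences_int xy)
    ultimately have "((\<lambda>n. \<gamma> m / real K ^ 2 * (1 / (x - y m + of_int n) ^ 2) +
        \<delta> m / (2 * real K) * (1 / (x - y m + of_int n) - 1 / (x - y (\<sigma> m) + of_int n))) has_sum
        (\<gamma> m / real K ^ 2 * (pi / sin (pi * (x - y m))) ^ 2 +
         \<delta> m / (2 * real K) * (pi * cot (pi * (x - y m)) - pi * cot (pi * (x - y (\<sigma> m)))))) UNIV"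
      by (rule has_sum_add)
    moreover have "\<gamma> m / real K ^ 2 * (1 / (x - y m + of_int n) ^ 2) +
        \<delta> m / (2 * real K) * (1 / (x - y m + of_int n) - 1 / (x - y (\<sigma> m) + of_int n)) = t n m" for n
    proof -
      have "g / k ^ 2 * (1 / P ^ 2) + d / (2 * k) * (1 / P - 1 / Q) =
              g / (k * P) ^ 2 + d * ((1 / (k * P) - 1 / (k * Q)) / 2)" for g d k P Q :: real
        by (simp add: power_mult_distrib diff_divide_distrib right_diff_distrib mult_ac)
      then show ?thesis unfolding t_def e by blast
    qed
    moreover have "\<gamma> m / real K ^ 2 * (pi / sin (pi * (x - y m))) ^ 2 +
         \<delta> m / (2 * real K) * (pi * cot (pi * (x - y m)) - pi * cot (pi * (x - y (\<sigma> m)))) =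
         V m + (U m + U (\<sigma> m)) * (1 / 2)"
    proof -
      have "g / k ^ 2 * (pi / S) ^ 2 + d / (2 * k) * (pi * A - pi * B) =
              g * (pi / (k * S)) ^ 2 + (d * (pi / k * A) + - d * (pi / k * B)) * (1 / 2)" for g d k S A B :: real
        by (simp add: power_mult_distrib power_divide diff_divide_distrib right_diff_distrib mult_ac)
      moreover have "\<delta> (\<sigma> m) = - \<delta> m" using odd[of m] by (simp add: \<sigma>_def)
      ultimately show ?thesis unfolding V_def U_def by simp
    qed
    ultimately show ?thesis by simp
  qed
  then have 2: "((\<lambda>m. V m + (U m + U (\<sigma> m)) * (1 / 2)) has_sum S) UNIV"
    using has_sum_SigmaD[where f = "\<lambda>(m, n). t n m" and S = S and A = UNIV and B = "\<lambda>_. UNIV"]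
      has_sum_swap[where f = "\<lambda>(n, m). t n m" and S = S and A = UNIV and B = UNIV] S
    by (simp add: case_prod_unfold)
  have yper: "x - y (int j + int K * p) = x - X j - of_int p" for j p
    using K by (simp add: y_def a_def X field_simps)
  have per: "sin (pi * (u - of_int p)) ^ 2 = sin (pi * u) ^ 2" "cot (pi * (u - of_int p)) = cot (pi * u)" for u and p :: int
  proof -
    have sp: "sin (pi * of_int p) = 0" "cos (pi * of_int p) ^ 2 = 1"
      using sin_npi_int[of p] sin_cos_squared_add[of "pi * of_int p"] by auto
    then have "cos (pi * of_int p) \<noteq> 0" by auto
    then show "sin (pi * (u - of_int p)) ^ 2 = sin (pi * u) ^ 2" "cot (pi * (u - of_int p)) = cot (pi * u)"
      using sp by (simp_all add: right_diff_distrib sin_diff cos_diff power_mult_distrib cot_def)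
  qed
  have sumK: "((\<lambda>m. g m * h m) has_sum (\<Sum>j<K. (\<Sum>\<^sub>\<infinity>p. g (int j + int K * p)) * H j)) UNIV"
    if "(\<lambda>m. \<bar>g m\<bar>) summable_on UNIV" "\<And>j p. h (int j + int K * p) = H j"
    for g h :: "int \<Rightarrow> real" and H :: "nat \<Rightarrow> real"
  proof (rule has_sum_residue_classes[OF K])
    fix j
    have "g summable_on UNIV" using that(1) by (intro abs_summable_summable[of g]) simp
    then have "g summable_on range (\<lambda>p. int j + int K * p)"
      by (rule summable_on_subset_banach) auto
    then have "(\<lambda>p. g (int j + int K * p)) summable_on UNIV"
      using K by (subst (asm) summable_on_reindex) (auto simp: inj_on_def o_def)
    then show "((\<lambda>p. g (int j + int K * p) * h (int j + int K * p)) has_sum (\<Sum>\<^sub>\<infinity>p. g (int j + int K * p)) * H j) UNIV"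
      unfolding that(2) by (intro has_sum_cmult_left has_sum_infsum)
  qed
  have V: "(V has_sum (\<Sum>j<K. (\<Sum>\<^sub>\<infinity>p. \<gamma> (int j + int K * p)) * (pi / (real K * sin (pi * (x - X j)))) ^ 2)) UNIV"
    unfolding V_def by (rule sumK[OF \<gamma>]) (simp add: yper per power_divide power_mult_distrib)
  have U: "(U has_sum (\<Sum>j<K. (\<Sum>\<^sub>\<infinity>p. \<delta> (int j + int K * p)) * (pi / real K * cot (pi * (x - X j))))) UNIV" (is "(U has_sum ?u) UNIV")
    unfolding U_def by (rule sumK[OF \<delta>(1)]) (simp add: yper per)
  then have "((\<lambda>m. U (\<sigma> m)) has_sum ?u) UNIV"
    using has_sum_reindex_bij_betw[OF bij\<sigma>] by blast
  then have "((\<lambda>m. V m + (U m + U (\<sigma> m)) * (1 / 2)) has_sum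
      ((\<Sum>j<K. (\<Sum>\<^sub>\<infinity>p. \<gamma> (int j + int K * p)) * (pi / (real K * sin (pi * (x - X j)))) ^ 2) + (?u + ?u) * (1 / 2))) UNIV"
    using U V by (intro has_sum_add has_sum_cmult_left)
  with 2 have "S = (\<Sum>j<K. (\<Sum>\<^sub>\<infinity>p. \<gamma> (int j + int K * p)) * (pi / (real K * sin (pi * (x - X j)))) ^ 2) + (?u + ?u) * (1 / 2)"
    by (rule has_sum_unique)
  then show ?thesis
    using 1 by (simp add: sum.distrib a_def)
qed

section \<open>Values of the entire interpolants\<close>

text \<open>
  The common form of the series behind \<open>L_fun\<close> (\<open>c = 1/2\<close>) and \<open>M_fun\<close> (\<open>c = 0\<close>), with interpolation
  points \<open>c + m\<close>.
\<close>

definition nodal_series :: "real \<Rightarrow> real \<Rightarrow> complex \<Rightarrow> complex" where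
  "nodal_series \<mu> c z = (sin (of_real pi * (z - of_real c)) / of_real pi) ^ 2 *
     ((\<Sum>\<^sub>\<infinity>m::int. gauss \<mu> (of_real (c + of_int m)) / (z - of_real (c + of_int m)) ^ 2) +
      (\<Sum>\<^sub>\<infinity>m::int. deriv (gauss \<mu>) (of_real (c + of_int m)) / (z - of_real (c + of_int m))))"

lemma L_fun_eq_nodal_series: "L_fun \<mu> = remove_sings (nodal_series \<mu> (1 / 2))"
proof -
  have "cos (of_real pi * z) = - sin (of_real pi * (z - of_real (1 / 2)))" for z :: complex
  proof -
    have "of_real pi * (z - of_real (1 / 2)) = of_real pi * z - of_real (pi / 2)"
      by (simp add: algebra_simps)
    then show ?thesis
      by (simp only: sin_diff sin_of_real[symmetric] cos_of_real[symmetric]) (simp add: cos_of_real sin_of_real)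
  qed
  then have 1: "(cos (of_real pi * z) / of_real pi) ^ 2 = (sin (of_real pi * (z - of_real (1 / 2))) / of_real pi) ^ 2" for z :: complex
    by (simp add: power_divide)
  have 2: "of_real (1 / 2 + of_int m) = of_int m + (1 / 2 :: complex)" for m by simp
  have 3: "z - (of_int m + 1 / 2) = z - of_int m - (1 / 2 :: complex)" for z and m :: int by simp
  show ?thesis
    unfolding L_fun_def nodal_series_def[abs_def] 1 2 3 ..
qed

lemma M_fun_eq_nodal_series: "M_fun \<mu> = remove_sings (nodal_series \<mu> 0)"
  by (simp add: M_fun_def nodal_series_def[abs_def])

lemma gauss_of_real: "gauss \<mu> (of_real t) = of_real (exp (- (pi * \<mu>) * t ^ 2))"
  by (simp add: gauss_def exp_of_real[symmetric])

lemma deriv_gauss_of_real: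
  "deriv (gauss \<mu>) (of_real t) = of_real (- (2 * pi * \<mu>) * t * exp (- (pi * \<mu>) * t ^ 2))"
proof -
  have "(gauss \<mu> has_field_derivative - (2 * of_real (pi * \<mu>)) * z * gauss \<mu> z) (at z)" for z
    unfolding gauss_def[abs_def] by (auto intro!: derivative_eq_intros)
  then have "deriv (gauss \<mu>) (of_real t) = - (2 * of_real (pi * \<mu>)) * of_real t * gauss \<mu> (of_real t)"
    by (rule DERIV_imp_deriv)
  then show ?thesis by (simp only: gauss_of_real) simp
qed

text \<open>
  Away from the interpolation points the partial fraction series is dominated, uniformly in a
  neighbourhood, by a multiple of its coefficients. The index set \<open>A\<close> allows a single
  point to be left out, which isolates the pole at that point.
\<close>

lemma isCont_nodal_sum:
  fixes g :: "int \<Rightarrow> complex" and z0 :: complex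
  assumes "(\<lambda>m. norm (g m)) summable_on A" "q > 0" "\<And>m. m \<in> A \<Longrightarrow> 2 * q \<le> norm (z0 - a m)"
  shows "isCont (\<lambda>z. \<Sum>\<^sub>\<infinity>m\<in>A. g m / (z - a m) ^ e) z0"
    and "\<And>z. z \<in> ball z0 q \<Longrightarrow> (\<lambda>m. g m / (z - a m) ^ e) summable_on A"
proof -
  have far: "q \<le> norm (z - a m)" if "m \<in> A" "z \<in> ball z0 q" for m z
    using assms(3)[OF that(1)] that(2) norm_triangle_ineq[of "z0 - z" "z - a m"]
    by (simp add: dist_norm)
  have bound: "norm (g m / (z - a m) ^ e) \<le> norm (g m) * (1 / q ^ e)" if "m \<in> A" "z \<in> ball z0 q" for m z
  proof -
    have "q ^ e \<le> norm (z - a m) ^ e"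
      using far[OF that] assms(2) by (intro power_mono) auto
    then have "norm (g m) / norm (z - a m) ^ e \<le> norm (g m) / q ^ e"
      using assms(2) by (intro frac_le) auto
    then show ?thesis by (simp add: norm_divide norm_power)
  qed
  have M: "(\<lambda>m. norm (g m) * (1 / q ^ e)) summable_on A"
    by (intro summable_on_cmult_left assms(1))
  have "continuous_on (ball z0 q) (\<lambda>z. \<Sum>\<^sub>\<infinity>m\<in>A. g m / (z - a m) ^ e)"
  proof (rule continuous_on_infsum[OF _ bound M])
    fix m assume m: "m \<in> A"
    have "z - a m \<noteq> 0" if "z \<in> ball z0 q" for z
      using far[OF m that] assms(2) by auto
    then show "continuous_on (ball z0 q) (\<lambda>z. g m / (z - a m) ^ e)"
      by (intro continuous_intros) auto
  qed
  then show "isCont (\<lambda>z. \<Sum>\<^sub>\<infinity>m\<in>A. g m / (z - a m) ^ e) z0"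
    using assms(2) by (simp add: continuous_on_eq_continuous_at)
  show "(\<lambda>m. g m / (z - a m) ^ e) summable_on A" if "z \<in> ball z0 q" for z
    by (rule abs_summable_summable, rule summable_on_comparison_test[OF M])
       (use bound that in auto)
qed

lemma gauss_node_summable:
  assumes "\<mu> > 0"
  shows "(\<lambda>m::int. norm (gauss \<mu> (of_real (c + of_int m)))) summable_on UNIV"
    and "(\<lambda>m::int. norm (deriv (gauss \<mu>) (of_real (c + of_int m)))) summable_on UNIV"
proof -
  have a: "pi * \<mu> > 0" using assms by simp
  show "(\<lambda>m::int. norm (gauss \<mu> (of_real (c + of_int m)))) summable_on UNIV"
    unfolding gauss_of_real norm_of_real using summable_on_shifted_gaussian(1)[OF a, of c] by simp
  have "norm (deriv (gauss \<mu>) (of_real (c + of_int m))) =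
      (2 * pi * \<mu>) * (\<bar>c + of_int m\<bar> * exp (- (pi * \<mu>) * (c + of_int m) ^ 2))" for m
    unfolding deriv_gauss_of_real norm_of_real using assms by (simp add: abs_mult)
  then show "(\<lambda>m::int. norm (deriv (gauss \<mu>) (of_real (c + of_int m)))) summable_on UNIV"
    using summable_on_cmult_right[OF summable_on_shifted_gaussian(3)[OF a, of c], of "2 * pi * \<mu>"] by simp
qed

text \<open>
  The series is continuous at such a point, so removing singularities changes nothing there.
\<close>

lemma remove_sings_nodal_series_off_nodes:
  assumes "\<mu> > 0" "x - c \<notin> \<int>"
  shows "remove_sings (nodal_series \<mu> c) (of_real x) = of_real ((sin (pi * (x - c)) / pi) ^ 2 *
     ((\<Sum>\<^sub>\<infinity>m::int. exp (- (pi * \<mu>) * (c + of_int m) ^ 2) / (x - (c + of_int m)) ^ 2) +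
      (\<Sum>\<^sub>\<infinity>m::int. - (2 * pi * \<mu>) * (c + of_int m) * exp (- (pi * \<mu>) * (c + of_int m) ^ 2) / (x - (c + of_int m)))))"
proof -
  \<comment> \<open>Twice \<open>q\<close> is the distance from \<open>x\<close> to the nearest interpolation point.\<close>
  define q where "q = min (frac (x - c)) (1 - frac (x - c)) / 2"
  have q: "q > 0"
    using assms(2) frac_lt_1[of "x - c"] by (simp add: q_def frac_gt_0_iff)
  have dist: "2 * q \<le> norm (complex_of_real x - of_real (c + of_int m))" for m
  proof -
    define i where "i = \<lfloor>x - c\<rfloor> - m"
    have "complex_of_real x - of_real (c + of_int m) = of_real (frac (x - c) + of_int i)"
      by (simp add: frac_def i_def)
    then have "norm (complex_of_real x - of_real (c + of_int m)) = \<bar>frac (x - c) + of_int i\<bar>"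
      by (simp only: norm_of_real)
    moreover have "i \<ge> 0 \<or> i \<le> - 1" by linarith
    then have "real_of_int i \<ge> 0 \<or> real_of_int i \<le> - 1" by linarith
    ultimately show ?thesis
      using frac_ge_0[of "x - c"] frac_lt_1[of "x - c"] by (simp add: q_def) linarith
  qed
  have cont: "isCont (\<lambda>z. \<Sum>\<^sub>\<infinity>m. g m / (z - of_real (c + of_int m)) ^ e) (of_real x)"
      "z \<in> ball (of_real x) q \<Longrightarrow> (\<lambda>m. g m / (z - of_real (c + of_int m)) ^ e) summable_on UNIV"
    if "(\<lambda>m. norm (g m)) summable_on UNIV" for g :: "int \<Rightarrow> complex" and e z
    by (rule isCont_nodal_sum[OF that q]; use dist in simp)+
  note summ = gauss_node_summable[OF assms(1), of c]
  have "isCont (nodal_series \<mu> c) (of_real x)"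
    unfolding nodal_series_def[abs_def]
    using cont(1)[OF summ(1), where e = 2] cont(1)[OF summ(2), where e = 1]
    by (intro continuous_intros) auto
  then have "remove_sings (nodal_series \<mu> c) (of_real x) = nodal_series \<mu> c (of_real x)"
    by (intro remove_sings_eqI) (simp add: isCont_def)
  moreover have real: "infsum (\<lambda>m. complex_of_real (f m)) UNIV = of_real (infsum f UNIV)"
    if "(\<lambda>m. complex_of_real (f m)) summable_on UNIV" for f :: "int \<Rightarrow> real"
  proof -
    have "f summable_on UNIV"
      using summable_on_Re[OF that] by simp
    then show ?thesis by (intro infsumI has_sum_of_real) simp
  qed
  have x: "complex_of_real x \<in> ball (of_real x) q" using q by simp
  have "(\<Sum>\<^sub>\<infinity>m::int. gauss \<mu> (of_real (c + of_int m)) / (of_real x - of_real (c + of_int m)) ^ 2) =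
      of_real (\<Sum>\<^sub>\<infinity>m::int. exp (- (pi * \<mu>) * (c + of_int m) ^ 2) / (x - (c + of_int m)) ^ 2)"
    using real[of "\<lambda>m. exp (- (pi * \<mu>) * (c + of_int m) ^ 2) / (x - (c + of_int m)) ^ 2"] cont(2)[OF summ(1) x, where e = 2]
    unfolding gauss_of_real by (simp only: of_real_divide of_real_diff of_real_power)
  moreover have "(\<Sum>\<^sub>\<infinity>m::int. deriv (gauss \<mu>) (of_real (c + of_int m)) / (of_real x - of_real (c + of_int m))) =
      of_real (\<Sum>\<^sub>\<infinity>m::int. - (2 * pi * \<mu>) * (c + of_int m) * exp (- (pi * \<mu>) * (c + of_int m) ^ 2) / (x - (c + of_int m)))"
    using real[of "\<lambda>m. - (2 * pi * \<mu>) * (c + of_int m) * exp (- (pi * \<mu>) * (c + of_int m) ^ 2) / (x - (c + of_int m))"]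
      cont(2)[OF summ(2) x, where e = 1]
    unfolding deriv_gauss_of_real by (simp only: of_real_divide of_real_diff power_one_right)
  moreover have "sin (of_real pi * (of_real x - of_real c)) = complex_of_real (sin (pi * (x - c)))"
    by (metis sin_of_real of_real_mult of_real_diff)
  ultimately show ?thesis
    unfolding nodal_series_def by simp
qed

text \<open>
  Near the interpolation point \<open>a = c + i\<close> the factor \<open>(sin (pi * (z - c)) / pi)\<^sup>2\<close> is asymptotic to \<open>(z - a)\<^sup>2\<close>.
  It cancels the double pole, whose coefficient is \<open>gauss \<mu> a\<close>, while the simple pole and the rest of the
  series disappear in the limit.
\<close>

lemma remove_sings_nodal_series_at_node:
  fixes i :: int
  assumes "\<mu> > 0"
  shows "remove_sings (nodal_series \<mu> c) (of_real (c + of_int i)) = gauss \<mu> (of_real (c + of_int i))"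
proof (rule remove_sings_eqI)
  define a where "a m = complex_of_real (c + of_int m)" for m
  define g where "g m = gauss \<mu> (a m)" for m
  define d where "d m = deriv (gauss \<mu>) (a m)" for m
  have summ: "(\<lambda>m. norm (g m)) summable_on (UNIV - {i})" "(\<lambda>m. norm (d m)) summable_on (UNIV - {i})"
    using gauss_node_summable[OF assms, of c] by (auto simp: g_def d_def a_def intro: summable_on_subset_banach)
  have dist: "2 * (1 / 2) \<le> norm (a i - a m)" if "m \<in> UNIV - {i}" for m
  proof -
    have "a i - a m = of_int (i - m)" by (simp add: a_def)
    then have "norm (a i - a m) = \<bar>real_of_int (i - m)\<bar>" by (simp only: norm_of_int)
    moreover have "\<bar>i - m\<bar> \<ge> 1" using that by auto
    ultimately show ?thesis by linarith
  qed
  have half: "(0::real) < 1 / 2" by simp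
  define R1 where "R1 z = (\<Sum>\<^sub>\<infinity>m\<in>UNIV - {i}. g m / (z - a m) ^ 2)" for z
  define R2 where "R2 z = (\<Sum>\<^sub>\<infinity>m\<in>UNIV - {i}. d m / (z - a m) ^ 1)" for z
  have cont: "isCont R1 (a i)" "isCont R2 (a i)"
    unfolding R1_def R2_def
    by (rule isCont_nodal_sum[OF summ(1) half]; use dist in simp)
       (rule isCont_nodal_sum[OF summ(2) half]; use dist in simp)
  define s where "s z = sin (of_real pi * (z - of_real c))" for z :: complex
  \<comment> \<open>The quotient \<open>r\<close> tends to \<open>1\<close> or \<open>- 1\<close>, depending on the parity of \<open>i\<close>; its square tends to \<open>1\<close>.\<close>
  define r where "r z = s z / (z - a i) / of_real pi" for z
  have eq: "nodal_series \<mu> c z = r z ^ 2 * (g i + d i * (z - a i) + (z - a i) ^ 2 * (R1 z + R2 z))"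
    if z: "z \<in> ball (a i) (1 / 2)" "z \<noteq> a i" for z
  proof -
    have split: "infsum f UNIV = f i + infsum f (UNIV - {i})" if "f summable_on (UNIV - {i})" for f :: "int \<Rightarrow> complex"
      using infsum_insert[OF that, of i] by (simp add: insert_UNIV)
    have "(\<Sum>\<^sub>\<infinity>m. g m / (z - a m) ^ 2) = g i / (z - a i) ^ 2 + R1 z"
      unfolding R1_def by (rule split, rule isCont_nodal_sum(2)[OF summ(1) half]) (use z dist in auto)
    moreover have "(\<Sum>\<^sub>\<infinity>m. d m / (z - a m) ^ 1) = d i / (z - a i) ^ 1 + R2 z"
      unfolding R2_def by (rule split, rule isCont_nodal_sum(2)[OF summ(2) half]) (use z dist in auto)
    ultimately have "nodal_series \<mu> c z = (s z / of_real pi) ^ 2 * (g i / (z - a i) ^ 2 + R1 z + (d i / (z - a i) + R2 z))"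
      by (simp add: nodal_series_def s_def g_def d_def a_def)
    also have "\<dots> = r z ^ 2 * (g i + d i * (z - a i) + (z - a i) ^ 2 * (R1 z + R2 z))"
    proof -
      have "(S / P) ^ 2 * (G / u ^ 2 + A + (D / u + B)) = (S / u / P) ^ 2 * (G + D * u + u ^ 2 * (A + B))"
        if "u \<noteq> 0" "P \<noteq> 0" for S P G A B D u :: complex
        using that by (simp add: field_simps power2_eq_square)
      then show ?thesis using z(2) unfolding r_def by simp
    qed
    finally show ?thesis .
  qed
  have "(s has_field_derivative cos (of_real pi * (a i - of_real c)) * of_real pi) (at (a i))"
    unfolding s_def[abs_def] by (auto intro!: derivative_eq_intros)
  moreover have "of_real pi * (a i - of_real c) = of_real (pi * of_int i)"
    by (simp add: a_def)
  moreover have "s (a i) = 0"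
    unfolding s_def \<open>of_real pi * (a i - of_real c) = of_real (pi * of_int i)\<close>
    by (metis sin_of_real sin_npi_int of_real_0)
  ultimately have "(\<lambda>z. s z / (z - a i)) \<midarrow>a i\<rightarrow> of_real (cos (pi * of_int i)) * of_real pi"
    by (simp only: has_field_derivative_iff cos_of_real) simp
  then have r: "r \<midarrow>a i\<rightarrow> of_real (cos (pi * of_int i)) * of_real pi / of_real pi"
    unfolding r_def[abs_def] by (intro tendsto_intros) auto
  have "(\<lambda>z. r z ^ 2 * (g i + d i * (z - a i) + (z - a i) ^ 2 * (R1 z + R2 z))) \<midarrow>a i\<rightarrow>
      (of_real (cos (pi * of_int i)) * of_real pi / of_real pi) ^ 2 *
      (g i + d i * (a i - a i) + (a i - a i) ^ 2 * (R1 (a i) + R2 (a i)))"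
    using cont by (intro tendsto_intros r) (auto simp: isCont_def)
  also have "(of_real (cos (pi * of_int i)) * of_real pi / of_real pi) ^ 2 *
      (g i + d i * (a i - a i) + (a i - a i) ^ 2 * (R1 (a i) + R2 (a i))) = g i"
  proof -
    have "cos (pi * of_int i) ^ 2 = 1"
      using sin_npi_int[of i] sin_cos_squared_add[of "pi * of_int i"] by auto
    then show ?thesis by (simp flip: of_real_power)
  qed
  finally have "(\<lambda>z. r z ^ 2 * (g i + d i * (z - a i) + (z - a i) ^ 2 * (R1 z + R2 z))) \<midarrow>a i\<rightarrow> g i" .
  then have "nodal_series \<mu> c \<midarrow>a i\<rightarrow> g i"
    by (rule Lim_transform_within_open[where s = "ball (a i) (1 / 2)"]) (auto simp: eq)
  then show "nodal_series \<mu> c \<midarrow>of_real (c + of_int i)\<rightarrow> gauss \<mu> (of_real (c + of_int i))"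
    by (simp add: a_def g_def)
qed

section \<open>The periodized interpolants in closed form\<close>

definition nodal_poly :: "real \<Rightarrow> real \<Rightarrow> nat \<Rightarrow> real \<Rightarrow> complex" where
  "nodal_poly c lam N x = of_real (sqrt lam) * (\<Sum>\<^sub>\<infinity>n::int.
     remove_sings (nodal_series (lam / real (N + 1) ^ 2) c) (of_real (real (N + 1) * (x + of_int n))))"

lemma l_poly_eq_nodal_poly: "l_poly = nodal_poly (1 / 2)"
  by (intro ext) (simp only: l_poly_def nodal_poly_def L_fun_eq_nodal_series)

lemma m_poly_eq_nodal_poly: "m_poly = nodal_poly 0"
  by (intro ext) (simp only: m_poly_def nodal_poly_def M_fun_eq_nodal_series)

text \<open>
  When \<open>x\<close> is a node, so are all its translates by integers; the sum over the periods is then the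
  periodized Gaussian itself.
\<close>

lemma nodal_poly_at_node:
  assumes lam: "lam > 0" and x: "real (N + 1) * x - c \<in> \<int>"
  shows "nodal_poly c lam N x = of_real (gauss_periodization lam x)"
proof -
  define K where "K = real (N + 1)"
  have K: "K > 0" by (simp add: K_def)
  obtain i where i: "K * x - c = of_int i"
    using x by (auto simp: K_def elim: Ints_cases)
  have "remove_sings (nodal_series (lam / K ^ 2) c) (of_real (K * (x + of_int n))) =
          of_real (exp (- (pi * lam) * (x + of_int n) ^ 2))" for n
  proof -
    have "K * (x + of_int n) = c + of_int (i + int (N + 1) * n)"
      using i by (simp add: K_def algebra_simps)
    then have "remove_sings (nodal_series (lam / K ^ 2) c) (of_real (K * (x + of_int n))) =
        gauss (lam / K ^ 2) (of_real (K * (x + of_int n)))"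
      using remove_sings_nodal_series_at_node[of "lam / K ^ 2" c "i + int (N + 1) * n"] lam K by simp
    also have "\<dots> = of_real (exp (- (pi * lam) * (x + of_int n) ^ 2))"
      using K by (simp add: gauss_of_real power_mult_distrib del: of_real_mult of_real_add)
    finally show ?thesis .
  qed
  moreover have "(\<Sum>\<^sub>\<infinity>n::int. complex_of_real (exp (- (pi * lam) * (x + of_int n) ^ 2))) =
      of_real (\<Sum>\<^sub>\<infinity>n::int. exp (- (pi * lam) * (x + of_int n) ^ 2))"
    using summable_on_shifted_gaussian(1)[of "pi * lam" x] lam by (intro infsumI has_sum_of_real) simp
  ultimately show ?thesis
    unfolding nodal_poly_def gauss_periodization_def K_def[symmetric] by (simp only: of_real_mult)
qed

text \<open>
  This is the Hermite interpolation formula of \<open>trig_poly_hermite\<close> with the values and derivatives of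
  the periodized Gaussian as data.
\<close>

lemma nodal_poly_off_nodes:
  assumes lam: "lam > 0" and c: "2 * c = of_int s" and K: "K = N + 1"
    and x: "real K * x - c \<notin> \<int>" and X: "\<And>j. X j = (real j + c) / real K"
  shows "nodal_poly c lam N x = of_real (sin (pi * (real K * x - c)) ^ 2 / real K ^ 2 *
     (\<Sum>j<K. gauss_periodization lam (X j) * (1 / sin (pi * (x - X j)) ^ 2) +
              gauss_periodization_deriv lam (X j) / pi * cot (pi * (x - X j))))"
proof -
  define \<mu> where "\<mu> = lam / real K ^ 2"
  have K0: "K > 0" by (simp add: K)
  have \<mu>: "\<mu> > 0" using lam K0 by (simp add: \<mu>_def)
  then have a: "pi * \<mu> > 0" by simp
  define \<gamma> where "\<gamma> m = exp (- (pi * \<mu>) * (c + of_int m) ^ 2)" for m :: int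
  define \<delta> where "\<delta> m = - (2 * pi * \<mu>) * (c + of_int m) * \<gamma> m" for m
  define z where "z n = real K * (x + of_int n)" for n :: int
  define S where "S = (\<Sum>j<K. (\<Sum>\<^sub>\<infinity>p. \<gamma> (int j + int K * p)) * (pi / (real K * sin (pi * (x - X j)))) ^ 2 +
                    (\<Sum>\<^sub>\<infinity>p. \<delta> (int j + int K * p)) * (pi / real K * cot (pi * (x - X j))))"
  have S: "((\<lambda>n::int. (\<Sum>\<^sub>\<infinity>m. \<gamma> m / (z n - (c + of_int m)) ^ 2) + (\<Sum>\<^sub>\<infinity>m. \<delta> m / (z n - (c + of_int m)))) has_sum S) UNIV"
    unfolding S_def
  proof (rule has_sum_periodized_interpolation_series[OF K0 x c _ _ _ _ z_def X])
    show "(\<lambda>m. \<bar>\<gamma> m\<bar>) summable_on UNIV"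
      using summable_on_shifted_gaussian(1)[OF a, of c] by (simp add: \<gamma>_def)
    have "\<bar>\<delta> m\<bar> = 2 * pi * \<mu> * (\<bar>c + of_int m\<bar> * exp (- (pi * \<mu>) * (c + of_int m) ^ 2))" for m
      using \<mu> by (simp add: \<delta>_def \<gamma>_def abs_mult)
    then show "(\<lambda>m. \<bar>\<delta> m\<bar>) summable_on UNIV"
      using summable_on_cmult_right[OF summable_on_shifted_gaussian(3)[OF a, of c], of "2 * pi * \<mu>"] by simp
    have "\<bar>\<delta> m * (c + of_int m)\<bar> = 2 * pi * \<mu> * ((c + of_int m) ^ 2 * exp (- (pi * \<mu>) * (c + of_int m) ^ 2))" for m
      using \<mu> by (simp add: \<delta>_def \<gamma>_def abs_mult power2_eq_square)
    then show "(\<lambda>m. \<bar>\<delta> m * (c + of_int m)\<bar>) summable_on UNIV"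
      using summable_on_cmult_right[OF summable_on_gaussian_second_moment[OF a, of c], of "2 * pi * \<mu>"] by simp
    have "c + of_int (- m - s) = - (c + of_int m)" for m
      using c by simp
    then show "\<delta> (- m - s) = - \<delta> m" for m
      unfolding \<delta>_def \<gamma>_def by (simp only: power2_minus)
  qed
  define P where "P = sin (pi * (real K * x - c)) ^ 2"
  have "remove_sings (nodal_series \<mu> c) (of_real (z n)) = of_real (P / pi ^ 2 *
      ((\<Sum>\<^sub>\<infinity>m. \<gamma> m / (z n - (c + of_int m)) ^ 2) + (\<Sum>\<^sub>\<infinity>m. \<delta> m / (z n - (c + of_int m)))))" for n
  proof -
    have zn: "z n - c = (real K * x - c) + of_int (int K * n)"
      by (simp add: z_def algebra_simps)
    have "z n - c \<notin> \<int>"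
      using x unfolding zn by (metis Ints_diff Ints_of_int add_diff_cancel_right')
    moreover have "sin (pi * (z n - c)) ^ 2 = P"
    proof -
      have "sin (pi * of_int (int K * n)) = 0" "cos (pi * of_int (int K * n)) ^ 2 = 1"
        using sin_npi_int[of "int K * n"] sin_cos_squared_add[of "pi * of_int (int K * n)"] by auto
      then show ?thesis
        unfolding zn P_def distrib_left sin_add by (simp add: power_mult_distrib)
    qed
    ultimately show ?thesis
      using remove_sings_nodal_series_off_nodes[OF \<mu>, of "z n" c] by (simp add: \<gamma>_def \<delta>_def power_divide)
  qed
  moreover have "((\<lambda>n. complex_of_real (P / pi ^ 2 *
      ((\<Sum>\<^sub>\<infinity>m. \<gamma> m / (z n - (c + of_int m)) ^ 2) + (\<Sum>\<^sub>\<infinity>m. \<delta> m / (z n - (c + of_int m)))))) has_sum of_real (P / pi ^ 2 * S)) UNIV"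
    by (intro has_sum_of_real has_sum_cmult_right S)
  ultimately have "nodal_poly c lam N x = of_real (sqrt lam) * of_real (P / pi ^ 2 * S)"
    unfolding nodal_poly_def K[symmetric] \<mu>_def[symmetric] z_def[symmetric] by (simp only: infsumI)
  also have "\<dots> = of_real (P / real K ^ 2 * (real K ^ 2 / pi ^ 2 * (sqrt lam * S)))"
    using K0 by simp
  also have "real K ^ 2 / pi ^ 2 * (sqrt lam * S) =
      (\<Sum>j<K. gauss_periodization lam (X j) * (1 / sin (pi * (x - X j)) ^ 2) +
              gauss_periodization_deriv lam (X j) / pi * cot (pi * (x - X j)))"
    unfolding S_def sum_distrib_left
  proof (rule sum.cong)
    fix j
    have node: "c + of_int (int j + int K * p) = real K * (X j + of_int p)" for p
      using K0 by (simp add: X field_simps)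
    have \<gamma>': "\<gamma> (int j + int K * p) = exp (- (pi * lam) * (X j + of_int p) ^ 2)" for p
      using K0 unfolding \<gamma>_def node by (simp add: \<mu>_def power_mult_distrib)
    have "\<delta> (int j + int K * p) = 1 / real K * (- (2 * pi * lam) * (X j + of_int p) * exp (- (pi * lam) * (X j + of_int p) ^ 2))" for p
      using K0 unfolding \<delta>_def \<gamma>' node by (simp add: \<mu>_def power2_eq_square)
    then have \<Delta>: "sqrt lam * (\<Sum>\<^sub>\<infinity>p. \<delta> (int j + int K * p)) = gauss_periodization_deriv lam (X j) / real K"
      unfolding gauss_periodization_deriv_def by (simp only: infsum_cmult_right') simp
    have \<Gamma>: "sqrt lam * (\<Sum>\<^sub>\<infinity>p. \<gamma> (int j + int K * p)) = gauss_periodization lam (X j)"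
      unfolding gauss_periodization_def \<gamma>' ..
    have "k ^ 2 / pi ^ 2 * (r * (g * (pi / (k * u)) ^ 2 + d * (pi / k * v))) =
             (r * g) * (1 / u ^ 2) + (r * d) * k / pi * v" if "k > 0" for k r g u d v :: real
      using that by (simp add: power2_eq_square field_simps)
    from this[of "real K"] K0 show "real K ^ 2 / pi ^ 2 * (sqrt lam *
        ((\<Sum>\<^sub>\<infinity>p. \<gamma> (int j + int K * p)) * (pi / (real K * sin (pi * (x - X j)))) ^ 2 +
         (\<Sum>\<^sub>\<infinity>p. \<delta> (int j + int K * p)) * (pi / real K * cot (pi * (x - X j))))) =
      gauss_periodization lam (X j) * (1 / sin (pi * (x - X j)) ^ 2) +
              gauss_periodization_deriv lam (X j) / pi * cot (pi * (x - X j))"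
      by (simp add: \<Gamma> \<Delta>)
  qed simp
  finally show ?thesis by (simp add: P_def)
qed

section \<open>The extremal problem\<close>

lemma has_integral_e2pi:
  "((\<lambda>x. e2pi (of_int n * of_real x)) has_integral of_bool (n = 0)) {0..1}"
proof (cases "n = 0")
  case True
  then show ?thesis using has_integral_const_real[of "1::complex" 0 1] by (simp add: e2pi_def)
next
  case False
  define k where "k = 2 * of_real pi * \<i> * of_int n"
  have k: "k \<noteq> 0" using False by (simp add: k_def)
  have "((\<lambda>z. e2pi (of_int n * z) / k) has_field_derivative e2pi (of_int n * z)) (at z)" for z
    unfolding e2pi_def using k by (auto intro!: derivative_eq_intros simp: k_def)
  then have "((\<lambda>x. e2pi (of_int n * of_real x)) has_integral
      (e2pi (of_int n * of_real 1) / k - e2pi (of_int n * of_real 0) / k)) {0..1}"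
    by (intro fundamental_theorem_of_calculus has_vector_derivative_real_field) auto
  moreover have "e2pi (of_int n * of_real 1) = e2pi (of_int n * of_real 0)"
    by (simp add: e2pi_def[of 0])
  ultimately show ?thesis using False by simp
qed

text \<open>
  Both the integral and the average over the nodes single out the coefficient of frequency 0.
\<close>

lemma real_trig_poly_integral:
  assumes "real_trig_poly N q"
  shows "integral {0..1} q = (\<Sum>j<N + 1. q ((real j + \<theta>) / real (N + 1))) / real (N + 1)"
proof -
  obtain c where c: "\<And>x. complex_of_real (q x) = (\<Sum>n = - int N..int N. c n * e2pi (of_int n * of_real x))"
    using assms by (auto simp: real_trig_poly_def trig_poly_def)
  have "((\<lambda>x. complex_of_real (q x)) has_integral (\<Sum>n = - int N..int N. c n * of_bool (n = 0))) {0..1}"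
    unfolding c by (intro has_integral_sum has_integral_mult_right has_integral_e2pi) auto
  moreover have "(\<Sum>n = - int N..int N. c n * of_bool (n = 0)) = (\<Sum>n = - int N..int N. if n = 0 then c 0 else 0)"
    by (intro sum.cong) auto
  ultimately have "((\<lambda>x. complex_of_real (q x)) has_integral c 0) {0..1}"
    by simp
  then have "((\<lambda>x. Re (complex_of_real (q x))) has_integral Re (c 0)) {0..1}"
    using has_integral_linear[OF _ bounded_linear_Re, of "\<lambda>x. complex_of_real (q x)"] by (simp add: o_def)
  then have "integral {0..1} q = Re (c 0)"
    by (simp add: integral_unique)
  moreover have "complex_of_real (\<Sum>j<N + 1. q ((real j + \<theta>) / real (N + 1))) = of_nat (N + 1) * c 0"
    using trig_poly_quadrature[of "\<lambda>x. complex_of_real (q x)", OF c, of \<theta>] by simp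
  then have "Re (complex_of_real (\<Sum>j<N + 1. q ((real j + \<theta>) / real (N + 1)))) = Re (of_nat (N + 1) * c 0)"
    by (simp only:)
  then have "(\<Sum>j<N + 1. q ((real j + \<theta>) / real (N + 1))) = real (N + 1) * Re (c 0)"
    unfolding Re_complex_of_real by simp
  ultimately show ?thesis by simp
qed

text \<open>
  The factor \<open>\<sigma>\<close> is 1 for minorants and \<open>- 1\<close> for majorants. Equality makes the nonnegative function
  \<open>\<sigma> * (P - q)\<close> vanish at the nodes, where it consequently has a minimum and a zero derivative, and
  Hermite interpolation identifies \<open>q\<close>.
\<close>

lemma extremal_interpolation:
  fixes q :: "real \<Rightarrow> real" and c lam \<sigma> :: real
  assumes lam: "lam > 0" and c: "2 * c = of_int s" and q: "real_trig_poly N q"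
    and \<sigma>: "\<sigma> \<noteq> 0" "\<And>x. 0 \<le> \<sigma> * (gauss_periodization lam x - q x)"
  shows "0 \<le> \<sigma> * (gauss_periodization (lam / real (N + 1) ^ 2) c - integral {0..1} q)"
    and "integral {0..1} q = gauss_periodization (lam / real (N + 1) ^ 2) c \<longleftrightarrow>
           (\<forall>x. complex_of_real (q x) = nodal_poly c lam N x)"
proof -
  define K where "K = N + 1"
  have K: "K > 0" by (simp add: K_def)
  define X where "X j = (real j + c) / real K" for j
  define P where "P = gauss_periodization lam"
  have mean: "gauss_periodization (lam / real K ^ 2) c - integral {0..1} q = (\<Sum>j<K. P (X j) - q (X j)) / real K"
    using average_gauss_periodization[OF lam K, of c] real_trig_poly_integral[OF q, of c, folded K_def]
    by (simp add: P_def X_def sum_subtractf diff_divide_distrib)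
  then have mean': "\<sigma> * (gauss_periodization (lam / real K ^ 2) c - integral {0..1} q) =
      (\<Sum>j<K. \<sigma> * (P (X j) - q (X j))) / real K"
    by (simp add: sum_distrib_left)
  have nonneg: "0 \<le> \<sigma> * (P x - q x)" for x using \<sigma>(2) by (simp add: P_def)
  show "0 \<le> \<sigma> * (gauss_periodization (lam / real (N + 1) ^ 2) c - integral {0..1} q)"
    unfolding K_def[symmetric] mean' by (intro divide_nonneg_nonneg sum_nonneg nonneg) auto
  obtain C where C: "\<And>x. complex_of_real (q x) = (\<Sum>n = - int N..int N. C n * e2pi (of_int n * of_real x))"
    using q by (auto simp: real_trig_poly_def trig_poly_def)
  define Q where "Q x = (\<Sum>n = - int N..int N. C n * (2 * of_real pi * \<i> * of_int n) * e2pi (of_int n * of_real x))" for x :: real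
  have "((\<lambda>z. \<Sum>n = - int N..int N. C n * e2pi (of_int n * z)) has_field_derivative Q x) (at (of_real x))" for x
    unfolding e2pi_def Q_def by (auto intro!: derivative_eq_intros sum.cong simp: mult_ac)
  then have "((\<lambda>x. complex_of_real (q x)) has_vector_derivative Q x) (at x)" for x
    unfolding C by (rule has_vector_derivative_real_field)
  then have "((\<lambda>x. Re (complex_of_real (q x))) has_vector_derivative Re (Q x)) (at x)"
    "((\<lambda>x. Im (complex_of_real (q x))) has_vector_derivative Im (Q x)) (at x)" for x
    using bounded_linear.has_vector_derivative[OF bounded_linear_Re] bounded_linear.has_vector_derivative[OF bounded_linear_Im]
    by blast+
  then have dq: "(q has_real_derivative Re (Q x)) (at x)"
    and "((\<lambda>x. 0) has_real_derivative Im (Q x)) (at x)" for x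
    by (simp_all add: has_real_derivative_iff_has_vector_derivative)
  \<comment> \<open>The derivative of the real function \<open>q\<close> is real, although \<open>Q\<close> is given by complex coefficients.\<close>
  then have "Im (Q x) = 0" for x
    using DERIV_unique DERIV_const by blast
  then have Q: "Q x = of_real (Re (Q x))" for x
    by (simp add: complex_eq_iff)
  have dP: "(P has_real_derivative gauss_periodization_deriv lam x) (at x)" for x
    unfolding P_def by (rule has_derivative_gauss_periodization[OF lam])
  have node: "real (N + 1) * X j - c \<in> \<int>" for j
    using K by (simp add: X_def K_def)
  show "integral {0..1} q = gauss_periodization (lam / real (N + 1) ^ 2) c \<longleftrightarrow>
           (\<forall>x. complex_of_real (q x) = nodal_poly c lam N x)"
  proof
    assume "\<forall>x. complex_of_real (q x) = nodal_poly c lam N x"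
    then have "complex_of_real (q (X j)) = of_real (P (X j))" for j
      using nodal_poly_at_node[OF lam node] by (simp add: P_def)
    then have "q (X j) = P (X j)" for j
      by (simp only: of_real_eq_iff)
    then show "integral {0..1} q = gauss_periodization (lam / real (N + 1) ^ 2) c"
      using mean by (simp add: K_def)
  next
    assume "integral {0..1} q = gauss_periodization (lam / real (N + 1) ^ 2) c"
    then have "(\<Sum>j<K. \<sigma> * (P (X j) - q (X j))) = 0"
      using mean' K by (simp add: K_def)
    then have eq: "q (X j) = P (X j)" if "j < K" for j
      using that nonneg \<sigma>(1) by (subst (asm) sum_nonneg_eq_0_iff) auto
    have eq': "Re (Q (X j)) = gauss_periodization_deriv lam (X j)" if "j < K" for j
    proof -
      have "((\<lambda>x. \<sigma> * (P x - q x)) has_real_derivative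
              \<sigma> * (gauss_periodization_deriv lam (X j) - Re (Q (X j)))) (at (X j))"
        by (intro DERIV_cmult DERIV_diff dP dq)
      then have "\<sigma> * (gauss_periodization_deriv lam (X j) - Re (Q (X j))) = 0"
        by (rule DERIV_local_min[where d = 1]) (use eq[OF that] nonneg in auto)
      then show ?thesis using \<sigma>(1) by simp
    qed
    show "\<forall>x. complex_of_real (q x) = nodal_poly c lam N x"
    proof
      fix x
      show "complex_of_real (q x) = nodal_poly c lam N x"
      proof (cases "real K * x - c \<in> \<int>")
        case True
        then obtain i where i: "real K * x - c = of_int i" by (auto elim: Ints_cases)
        define j where "j = nat (i mod int K)"
        have j: "j < K" "int j = i mod int K"
          using K by (auto simp: j_def nat_less_iff)
        have x: "x = X j + of_int (i div int K)"
        proof -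
          have "real_of_int i = real j + real K * of_int (i div int K)"
            using j(2) by (metis mult_div_mod_eq of_int_add of_int_mult of_int_of_nat_eq add.commute)
          then show ?thesis using i K by (simp add: X_def field_simps)
        qed
        have "q (y + 1) = q y" for y
        proof -
          have "complex_of_real (q (y + 1)) = of_real (q y)"
            unfolding C by (simp add: distrib_left e2pi_add)
          then show ?thesis by (simp only: of_real_eq_iff)
        qed
        then have "q x = q (X j)"
          unfolding x by (rule periodic_of_int[of q])
        also have "\<dots> = P (X j)" using eq j by blast
        also have "\<dots> = P x"
          unfolding x by (rule periodic_of_int[symmetric]) (simp add: P_def gauss_periodization_plus_1[OF lam])
        finally show ?thesis
          using nodal_poly_at_node[OF lam, of N x c] True by (simp add: P_def K_def)
      next
        case False
        have sin: "sin (pi * (real K * x - c)) \<noteq> 0"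
        proof
          assume "sin (pi * (real K * x - c)) = 0"
          then obtain i where "pi * (real K * x - c) = pi * of_int i"
            by (metis sin_zero_iff_int2 mult.commute)
          then have "real K * x - c = of_int i" by simp
          then show False using False by simp
        qed
        let ?S = "\<Sum>j<K. P (X j) * (1 / sin (pi * (x - X j)) ^ 2) +
              gauss_periodization_deriv lam (X j) / pi * cot (pi * (x - X j))"
        have "of_real ?S = (\<Sum>j<K. complex_of_real (q (X j)) * of_real (1 / sin (pi * (x - X j)) ^ 2) +
            Q (X j) / of_real pi * of_real (cot (pi * (x - X j))))"
          unfolding of_real_sum by (intro sum.cong refl) (subst Q, simp add: eq eq')
        also have "\<dots> = of_nat K ^ 2 * complex_of_real (q x) * of_real (1 / sin (pi * (real K * x - c)) ^ 2)"
          by (rule trig_poly_hermite[OF C Q_def _ K_def X_def]) (use sin in \<open>simp add: K_def\<close>)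
        also have "\<dots> = of_real (real K ^ 2 * q x * (1 / sin (pi * (real K * x - c)) ^ 2))"
          by simp
        finally have "?S = real K ^ 2 * q x * (1 / sin (pi * (real K * x - c)) ^ 2)"
          by (simp only: of_real_eq_iff)
        then have "sin (pi * (real K * x - c)) ^ 2 / real K ^ 2 * ?S = q x"
          using sin K by simp
        then show ?thesis
          using nodal_poly_off_nodes[OF lam c K_def False X_def] by (simp only: P_def)
      qed
    qed
  qed
qed

theorem theorem6:
  fixes lam :: real and N :: nat
  assumes "lam > 0"
  shows "(\<forall>q :: real \<Rightarrow> real.
            real_trig_poly N q \<longrightarrow>
            (\<forall>x. q x \<le> Re (theta3 (of_real x) (\<i> * of_real (inverse lam)))) \<longrightarrow>
              integral {0..1} q \<le> Re (theta2 0 (\<i> * of_real (inverse lam * real (N + 1) ^ 2))) \<and>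
              (complex_of_real (integral {0..1} q) =
                 theta2 0 (\<i> * of_real (inverse lam * real (N + 1) ^ 2))
               \<longleftrightarrow> (\<forall>x. complex_of_real (q x) = l_poly lam N x))) \<and>
         (\<forall>r :: real \<Rightarrow> real.
            real_trig_poly N r \<longrightarrow>
            (\<forall>x. Re (theta3 (of_real x) (\<i> * of_real (inverse lam))) \<le> r x) \<longrightarrow>
              Re (theta3 0 (\<i> * of_real (inverse lam * real (N + 1) ^ 2))) \<le> integral {0..1} r \<and>
              (theta3 0 (\<i> * of_real (inverse lam * real (N + 1) ^ 2)) =
                 complex_of_real (integral {0..1} r)
               \<longleftrightarrow> (\<forall>x. complex_of_real (r x) = m_poly lam N x)))"
proof -
  define \<mu> where "\<mu> = lam / real (N + 1) ^ 2"
  have "\<mu> > 0" using assms by (simp add: \<mu>_def)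
  moreover have "inverse lam * real (N + 1) ^ 2 = inverse \<mu>"
    by (simp add: \<mu>_def field_simps)
  ultimately have th: "theta2 0 (\<i> * of_real (inverse lam * real (N + 1) ^ 2)) = of_real (gauss_periodization \<mu> (1 / 2))"
    "theta3 0 (\<i> * of_real (inverse lam * real (N + 1) ^ 2)) = of_real (gauss_periodization \<mu> 0)"
    using theta3_eq_gauss_periodization[of \<mu> "1 / 2"] theta3_eq_gauss_periodization[of \<mu> 0]
    by (simp_all only: theta3_half_eq_theta2 of_real_0)
  have half: "2 * (1 / 2) = real_of_int 1" and zero: "2 * 0 = real_of_int 0" by auto
  show ?thesis
    unfolding th theta3_eq_gauss_periodization[OF assms] l_poly_eq_nodal_poly m_poly_eq_nodal_poly
      Re_complex_of_real of_real_eq_iff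
  proof (intro conjI allI impI)
    fix q assume q: "real_trig_poly N q" "\<forall>x. q x \<le> gauss_periodization lam x"
    note E = extremal_interpolation[OF assms half q(1), of 1, folded \<mu>_def]
    show "integral {0..1} q \<le> gauss_periodization \<mu> (1 / 2)"
      using E(1) q(2) by simp
    show "integral {0..1} q = gauss_periodization \<mu> (1 / 2) \<longleftrightarrow> (\<forall>x. complex_of_real (q x) = nodal_poly (1 / 2) lam N x)"
      using E(2) q(2) by simp
  next
    fix r assume r: "real_trig_poly N r" "\<forall>x. gauss_periodization lam x \<le> r x"
    note E = extremal_interpolation[OF assms zero r(1), of "- 1", folded \<mu>_def]
    show "gauss_periodization \<mu> 0 \<le> integral {0..1} r"
      using E(1) r(2) by simp
    show "gauss_periodization \<mu> 0 = integral {0..1} r \<longleftrightarrow> (\<forall>x. complex_of_real (r x) = nodal_poly 0 lam N x)"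
      using E(2) r(2) by (simp add: eq_commute)
  qed
qed

end
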